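(* Let $K$ be a strongly connected nice simplicial complex with odd subcomplex $K_{\mathrm{odd}}$, complete unfolding $p:\widetilde{K}\to K$ and partial unfolding $r:\widehat{K}\to K$. The restriction of $p$ to the pre-image $p^{-1}(K\setminus K_{\mathrm{odd}})$ of the complement of the odd subcomplex is a covering of $K\setminus K_{\mathrm{odd}}$. The same is true for each connected component $C$ of the partial unfolding: the restriction of $r$ to $C\cap r^{-1}(K\setminus K_{\mathrm{odd}})$ is a covering of $K\setminus K_{\mathrm{odd}}$.
   Context: Coverings are covering maps with connected covering space. $K$ is a locally finite simplicial complex, pure of dimension $d$ (every face lies in a $d$-dimensional face), identified with its geometric realization. Faces are non-empty simplices; $d$-dimensional faces are facets, codimension-$1$ faces are ridges; two distinct facets are neighbors if they share a ridge; $V(\sigma)$ is the vertex set of $\sigma$. A pure complex is strongly connected if any two facets are joined by a facet path, i.e. a sequence of facets with consecutive ones neighbors. $\operatorname{st}\kappa$ is the subcomplex of all faces of simplices containing $\kappa$; $\operatorname{lk}\kappa$ is the link. $K$ is locally strongly connected if $\operatorname{st}\kappa$ is strongly connected for each face $\kappa$; locally strongly simply connected if $\operatorname{lk}\kappa$ is simply connected for each face $\kappa$ with $\operatorname{codim}\kappa>2$; nice if both hold. A codimension-$2$-face is odd if its link (a graph) is not bipartite; $K_{\mathrm{odd}}$ is the subcomplex consisting of all odd codimension-$2$-faces and all their proper faces. For neighboring facets $\sigma,\tau$ the perspectivity $\langle\sigma,\tau\rangle:V(\sigma)\to V(\tau)$ is the bijection fixing all common vertices and sending the vertex of $\sigma$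 not in $\tau$ to the vertex of $\tau$ not in $\sigma$. For a facet path $\gamma=(\sigma_0,\dots,\sigma_n)$ put $\langle\gamma\rangle=\langle\sigma_0,\sigma_1\rangle\cdots\langle\sigma_{n-1},\sigma_n\rangle$ (maps composed left to right) and $\gamma^-=(\sigma_n,\dots,\sigma_0)$. Complete unfolding. Fix a facet $\sigma_0$ and a bijective coloring $b_0:V(\sigma_0)\to\{0,\dots,d\}$. A coloring of $V(\sigma)$, $\sigma$ a facet, is admissible if it has the form $\langle\eta^-\rangle b_0$ for some facet path $\eta$ from $\sigma_0$ to $\sigma$. Take a copy $(\sigma,b)$ of the simplex $\sigma$ for each facet $\sigma$ and each admissible coloring $b$ of $V(\sigma)$; for neighbors $\sigma,\tau$ glue $(\sigma,b)$ and $(\tau,c)$ by the identity along the common ridge $\rho$ whenever $b$ and $c$ coincide on the vertices of $\rho$. The quotient of the disjoint union by the generated equivalence relation is $\widetilde{K}$ (independent, up to isomorphism, of the choices), and $p$ is induced by the affine isomorphisms $(\sigma,b)\to\sigma$. Partial unfolding. Take a copy $(\sigma,v)$ of $\sigma$ for each facet $\sigma$ and each $v\in V(\sigma)$; for neighbors $\sigma,\tau$ glue $(\sigma,v)$ and $(\tau,w)$ by the identity along the common ridge whenever $w$ is the image of $v$ under $\langle\sigma,\tau\rangle$. The quotient is $\widehat{K}$, and $r$ is induced by the affine isomorphisms $(\sigma,v)\to\sigma$. *)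

theory Defs
  imports "HOL-Analysis.Analysis"
begin

section \<open>Simplicial complexes and their realizations\<close>

text \<open>A complex is given by its set of faces, and a face by its (finite, non-empty) set of
  vertices; thus the vertex set of a face is the face itself, and the dimension of a face is its
  cardinality minus one.\<close>

definition abstract_complex :: "'v set set \<Rightarrow> bool" where
  "abstract_complex K \<longleftrightarrow>
     (\<forall>\<sigma>\<in>K. finite \<sigma> \<and> \<sigma> \<noteq> {}) \<and> (\<forall>\<sigma>\<in>K. \<forall>\<tau>. \<tau> \<subseteq> \<sigma> \<and> \<tau> \<noteq> {} \<longrightarrow> \<tau> \<in> K)"

definition locally_finite_complex :: "'v set set \<Rightarrow> bool" where
  "locally_finite_complex K \<longleftrightarrow> (\<forall>v\<in>\<Union>K. finite {\<sigma>\<in>K. v \<in> \<sigma>})"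

text \<open>Points of the realization are given by their barycentric coordinates.\<close>

definition geo_simplex :: "'v set \<Rightarrow> ('v \<Rightarrow> real) set" where
  "geo_simplex \<sigma> = {x. (\<forall>v. 0 \<le> x v) \<and> (\<forall>v. v \<notin> \<sigma> \<longrightarrow> x v = 0) \<and> (\<Sum>v\<in>\<sigma>. x v) = 1}"

definition polyhedron_of :: "'v set set \<Rightarrow> ('v \<Rightarrow> real) set" where
  "polyhedron_of K = (\<Union>\<sigma>\<in>K. geo_simplex \<sigma>)"

text \<open>The realization carries the topology of pointwise convergence of the barycentric
  coordinates.  For locally finite complexes this is the weak (coherent) topology, see
  \<open>realization_weak_topology\<close> below.\<close>

abbreviation realization :: "'v set set \<Rightarrow> ('v \<Rightarrow> real) topology" where
  "realization K \<equiv> top_of_set (polyhedron_of K)"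

lemma closed_geo_simplex: "closed (geo_simplex \<sigma>)" for \<sigma> :: "'v set"
proof -
  have c: "continuous_on UNIV (\<lambda>x::'v \<Rightarrow> real. x v)" for v
    by simp
  have eq: "geo_simplex \<sigma> =
      (\<Inter>v. {x. 0 \<le> x v}) \<inter> (\<Inter>v\<in>-\<sigma>. {x. x v = 0}) \<inter> {x. (\<Sum>v\<in>\<sigma>. x v) = 1}"
    unfolding geo_simplex_def by auto
  show ?thesis
    unfolding eq
    by (intro closed_Int closed_INT ballI closed_Collect_le closed_Collect_eq
        continuous_on_const continuous_on_sum c)
qed

lemma realization_weak_topology:
  fixes K :: "'v set set"
  assumes K: "abstract_complex K" "locally_finite_complex K"
  shows "openin (realization K) U \<longleftrightarrow>
    U \<subseteq> polyhedron_of K \<and> (\<forall>\<sigma>\<in>K. openin (top_of_set (geo_simplex \<sigma>)) (U \<inter> geo_simplex \<sigma>))"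
    (is "?L \<longleftrightarrow> ?R")
proof
  assume ?L
  then obtain T where T: "open T" "U = polyhedron_of K \<inter> T"
    by (auto simp: openin_open)
  have "U \<inter> geo_simplex \<sigma> = geo_simplex \<sigma> \<inter> T" if "\<sigma> \<in> K" for \<sigma>
    using that T by (auto simp: polyhedron_of_def)
  then show ?R using T by (auto simp: openin_open)
next
  assume R: ?R
  have "\<exists>T. openin (realization K) T \<and> x \<in> T \<and> T \<subseteq> U" if x: "x \<in> U" for x
  proof -
    obtain \<sigma> where \<sigma>: "\<sigma> \<in> K" "x \<in> geo_simplex \<sigma>"
      using R x by (auto simp: polyhedron_of_def)
    have "\<exists>v\<in>\<sigma>. x v \<noteq> 0"
    proof (rule ccontr)
      assume "\<not> ?thesis"
      then have "sum x \<sigma> = 0" by (intro sum.neutral) auto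
      then show False using \<sigma>(2) by (simp add: geo_simplex_def)
    qed
    then obtain v where v: "v \<in> \<sigma>" "0 < x v"
      using \<sigma>(2) by (force simp: geo_simplex_def order_less_le)
    define F where "F = {\<tau>\<in>K. v \<in> \<tau>}"
    have fin: "finite F"
      using K(2) \<sigma> v by (auto simp: locally_finite_complex_def F_def)
    define C where "C = (\<Union>\<tau>\<in>F. geo_simplex \<tau> - U)"
    have "closed (geo_simplex \<tau> - U)" if "\<tau> \<in> F" for \<tau>
    proof -
      have "openin (top_of_set (geo_simplex \<tau>)) (U \<inter> geo_simplex \<tau>)"
        using R that by (auto simp: F_def)
      then have "closedin (top_of_set (geo_simplex \<tau>)) (geo_simplex \<tau> - U \<inter> geo_simplex \<tau>)"
        using closedin_diff[OF closedin_topspace] by (metis topspace_euclidean_subtopology)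
      moreover have "geo_simplex \<tau> - U \<inter> geo_simplex \<tau> = geo_simplex \<tau> - U" by auto
      ultimately show ?thesis
        using closed_geo_simplex closedin_closed_trans by metis
    qed
    then have C: "closed C"
      unfolding C_def by (intro closed_UN fin) blast
    have o: "open {y::'v \<Rightarrow> real. 0 < y v}"
      by (intro open_Collect_less continuous_on_const) simp
    define T where "T = polyhedron_of K \<inter> ({y. 0 < y v} - C)"
    have "openin (realization K) T"
      unfolding T_def using o C by (meson open_Diff openin_open_Int)
    moreover have "x \<in> T"
      using x v R by (auto simp: T_def C_def)
    moreover have "T \<subseteq> U"
    proof
      fix y assume y: "y \<in> T"
      then obtain \<tau> where \<tau>: "\<tau> \<in> K" "y \<in> geo_simplex \<tau>" "0 < y v"
        by (auto simp: T_def polyhedron_of_def)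
      then have "v \<in> \<tau>" by (force simp: geo_simplex_def)
      then show "y \<in> U" using y \<tau> by (auto simp: T_def C_def F_def)
    qed
    ultimately show ?thesis by blast
  qed
  then show ?L by (subst openin_subopen) blast
qed

section \<open>Facets, ridges, stars and links\<close>

definition facets :: "nat \<Rightarrow> 'v set set \<Rightarrow> 'v set set" where
  "facets d K = {\<sigma>\<in>K. card \<sigma> = d + 1}"

definition pure_complex :: "nat \<Rightarrow> 'v set set \<Rightarrow> bool" where
  "pure_complex d K \<longleftrightarrow> (\<forall>\<kappa>\<in>K. \<exists>\<sigma>\<in>facets d K. \<kappa> \<subseteq> \<sigma>)"

text \<open>The subtraction does not truncate on faces of a pure complex of dimension \<open>d\<close>.\<close>

definition codim :: "nat \<Rightarrow> 'v set \<Rightarrow> nat" where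
  "codim d \<kappa> = d + 1 - card \<kappa>"

definition ridges :: "nat \<Rightarrow> 'v set set \<Rightarrow> 'v set set" where
  "ridges d K = {\<rho>\<in>K. codim d \<rho> = 1}"

definition neighbors :: "nat \<Rightarrow> 'v set set \<Rightarrow> 'v set \<Rightarrow> 'v set \<Rightarrow> bool" where
  "neighbors d K \<sigma> \<tau> \<longleftrightarrow>
     \<sigma> \<in> facets d K \<and> \<tau> \<in> facets d K \<and> \<sigma> \<noteq> \<tau> \<and> (\<exists>\<rho>\<in>ridges d K. \<rho> \<subseteq> \<sigma> \<and> \<rho> \<subseteq> \<tau>)"

definition facet_path :: "nat \<Rightarrow> 'v set set \<Rightarrow> 'v set list \<Rightarrow> bool" where
  "facet_path d K \<gamma> \<longleftrightarrow> \<gamma> \<noteq> [] \<and> set \<gamma> \<subseteq> facets d K \<and> successively (neighbors d K) \<gamma>"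

definition strongly_connected :: "nat \<Rightarrow> 'v set set \<Rightarrow> bool" where
  "strongly_connected d K \<longleftrightarrow>
     (\<forall>\<sigma>\<in>facets d K. \<forall>\<tau>\<in>facets d K. \<exists>\<gamma>. facet_path d K \<gamma> \<and> hd \<gamma> = \<sigma> \<and> last \<gamma> = \<tau>)"

definition star :: "'v set set \<Rightarrow> 'v set \<Rightarrow> 'v set set" where
  "star K \<kappa> = {\<tau>\<in>K. \<exists>\<sigma>\<in>K. \<kappa> \<subseteq> \<sigma> \<and> \<tau> \<subseteq> \<sigma>}"

definition link :: "'v set set \<Rightarrow> 'v set \<Rightarrow> 'v set set" where
  "link K \<kappa> = {\<tau>\<in>K. \<tau> \<inter> \<kappa> = {} \<and> \<tau> \<union> \<kappa> \<in> K}"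

definition locally_strongly_connected :: "nat \<Rightarrow> 'v set set \<Rightarrow> bool" where
  "locally_strongly_connected d K \<longleftrightarrow> (\<forall>\<kappa>\<in>K. strongly_connected d (star K \<kappa>))"

definition locally_strongly_simply_connected :: "nat \<Rightarrow> 'v set set \<Rightarrow> bool" where
  "locally_strongly_simply_connected d K \<longleftrightarrow>
     (\<forall>\<kappa>\<in>K. codim d \<kappa> > 2 \<longrightarrow> simply_connected (polyhedron_of (link K \<kappa>)))"

definition nice_complex :: "nat \<Rightarrow> 'v set set \<Rightarrow> bool" where
  "nice_complex d K \<longleftrightarrow> locally_strongly_connected d K \<and> locally_strongly_simply_connected d K"

text \<open>A graph is a complex of dimension at most one, its edges being the two-element faces.\<close>

definition bipartite_graph :: "'v set set \<Rightarrow> bool" where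
  "bipartite_graph G \<longleftrightarrow>
     (\<exists>A B. A \<union> B = \<Union>G \<and> A \<inter> B = {} \<and> (\<forall>e\<in>G. card e = 2 \<longrightarrow> (\<exists>a\<in>A. \<exists>b\<in>B. e = {a, b})))"

definition odd_faces :: "nat \<Rightarrow> 'v set set \<Rightarrow> 'v set set" where
  "odd_faces d K = {\<kappa>\<in>K. codim d \<kappa> = 2 \<and> \<not> bipartite_graph (link K \<kappa>)}"

definition odd_subcomplex :: "nat \<Rightarrow> 'v set set \<Rightarrow> 'v set set" where
  "odd_subcomplex d K = {\<tau>\<in>K. \<exists>\<kappa>\<in>odd_faces d K. \<tau> \<subseteq> \<kappa>}"

definition odd_complement :: "nat \<Rightarrow> 'v set set \<Rightarrow> ('v \<Rightarrow> real) set" where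
  "odd_complement d K = polyhedron_of K - polyhedron_of (odd_subcomplex d K)"

section \<open>Perspectivities\<close>

text \<open>Maps defined on the vertex set of a facet are represented by functions that are
  \<^const>\<open>undefined\<close> outside of it, so that equality of functions is equality of maps.\<close>

definition perspectivity :: "'v set \<Rightarrow> 'v set \<Rightarrow> 'v \<Rightarrow> 'v" where
  "perspectivity \<sigma> \<tau> = (\<lambda>v\<in>\<sigma>. if v \<in> \<tau> then v else (THE w. w \<in> \<tau> - \<sigma>))"

text \<open>\<^term>\<open>compose\<close> composes right to left, so in the composition along a path the
  perspectivity of the first step is applied first.\<close>

fun projectivity :: "'v set list \<Rightarrow> 'v \<Rightarrow> 'v" where
  "projectivity [] = id"
| "projectivity [\<sigma>] = (\<lambda>v\<in>\<sigma>. v)"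
| "projectivity (\<sigma> # \<tau> # \<gamma>) = compose \<sigma> (projectivity (\<tau> # \<gamma>)) (perspectivity \<sigma> \<tau>)"

definition admissible_coloring ::
    "nat \<Rightarrow> 'v set set \<Rightarrow> 'v set \<Rightarrow> ('v \<Rightarrow> nat) \<Rightarrow> 'v set \<Rightarrow> ('v \<Rightarrow> nat) \<Rightarrow> bool" where
  "admissible_coloring d K \<sigma>\<^sub>0 b\<^sub>0 \<sigma> b \<longleftrightarrow>
     (\<exists>\<eta>. facet_path d K \<eta> \<and> hd \<eta> = \<sigma>\<^sub>0 \<and> last \<eta> = \<sigma> \<and>
          b = compose \<sigma> b\<^sub>0 (projectivity (rev \<eta>)))"

section \<open>Quotient spaces\<close>

definition generated_equiv :: "'a set \<Rightarrow> ('a \<times> 'a) set \<Rightarrow> ('a \<times> 'a) set" where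
  "generated_equiv A R = \<Inter>{E. equiv A E \<and> R \<subseteq> E}"

lemma equiv_generated_equiv:
  assumes "R \<subseteq> A \<times> A"
  shows "equiv A (generated_equiv A R)"
proof -
  let ?F = "{E. equiv A E \<and> R \<subseteq> E}"
  have "A \<times> A \<in> ?F"
    using assms by (simp add: equiv_def refl_on_def sym_def trans_def)
  then have 1: "\<Inter>?F \<subseteq> A \<times> A"
    by (rule Inter_lower)
  have 2: "refl_on A (\<Inter>?F)"
    by (simp add: equiv_def refl_on_def)
  have 3: "sym (\<Inter>?F)"
  proof (intro symI InterI)
    fix x y E assume "(x, y) \<in> \<Inter>?F" and E: "E \<in> ?F"
    then have "(x, y) \<in> E" by (rule InterD)
    then show "(y, x) \<in> E" using E by (simp add: equiv_def sym_def)
  qed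
  have 4: "trans (\<Inter>?F)"
  proof (intro transI InterI)
    fix x y z E assume xy: "(x, y) \<in> \<Inter>?F" and yz: "(y, z) \<in> \<Inter>?F" and E: "E \<in> ?F"
    have "(x, y) \<in> E" "(y, z) \<in> E"
      using InterD[OF xy E] InterD[OF yz E] .
    moreover have "trans E" using E by (simp add: equiv_def)
    ultimately show "(x, z) \<in> E" by (meson transE)
  qed
  show ?thesis
    unfolding generated_equiv_def by (rule equivI[OF 1 2 3 4])
qed

definition quotient_space :: "'a topology \<Rightarrow> ('a \<times> 'a) set \<Rightarrow> 'a set topology" where
  "quotient_space X E =
     topology (\<lambda>U. U \<subseteq> topspace X // E \<and> openin X {x \<in> topspace X. E `` {x} \<in> U})"

lemma openin_quotient_space:
  "openin (quotient_space X E) U \<longleftrightarrow>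
     U \<subseteq> topspace X // E \<and> openin X {x \<in> topspace X. E `` {x} \<in> U}"
proof -
  have 1: "{x \<in> topspace X. E `` {x} \<in> S \<inter> T} =
      {x \<in> topspace X. E `` {x} \<in> S} \<inter> {x \<in> topspace X. E `` {x} \<in> T}" for S T
    by auto
  have 2: "{x \<in> topspace X. E `` {x} \<in> \<Union>\<K>} = (\<Union>S\<in>\<K>. {x \<in> topspace X. E `` {x} \<in> S})" for \<K>
    by auto
  have "istopology (\<lambda>U. U \<subseteq> topspace X // E \<and> openin X {x \<in> topspace X. E `` {x} \<in> U})"
    unfolding istopology_def 1 2 by blast
  then show ?thesis
    by (simp add: quotient_space_def)
qed

lemma topspace_quotient_space [simp]: "topspace (quotient_space X E) = topspace X // E"
proof -
  have "{x \<in> topspace X. E `` {x} \<in> topspace X // E} = topspace X"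
    by (auto simp: quotientI)
  then have "openin (quotient_space X E) (topspace X // E)"
    by (simp add: openin_quotient_space)
  then show ?thesis
    by (metis openin_quotient_space openin_subset openin_topspace subset_antisym)
qed

lemma quotient_map_quotient_space:
  "quotient_map X (quotient_space X E) (\<lambda>x. E `` {x})"
  by (auto simp: quotient_map_def openin_quotient_space quotient_def)

section \<open>The unfoldings\<close>

text \<open>Both unfoldings are glued from labelled copies \<open>(\<sigma>, l)\<close> of the facets \<open>\<sigma>\<close>.
  The relation \<open>G\<close> tells which copies of neighboring facets are glued, by the identity,
  along their common ridge \<open>\<sigma> \<inter> \<tau>\<close>.\<close>

definition copies :: "('v set \<times> 'l) set \<Rightarrow> (('v set \<times> 'l) \<times> ('v \<Rightarrow> real)) topology" where
  "copies I = sum_topology (\<lambda>i. top_of_set (geo_simplex (fst i))) I"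

definition gluing :: "nat \<Rightarrow> 'v set set \<Rightarrow> ('v set \<times> 'l) set \<Rightarrow>
    ('v set \<times> 'l \<Rightarrow> 'v set \<times> 'l \<Rightarrow> bool) \<Rightarrow>
    ((('v set \<times> 'l) \<times> ('v \<Rightarrow> real)) \<times> (('v set \<times> 'l) \<times> ('v \<Rightarrow> real))) set" where
  "gluing d K I G =
     {((i, x), (j, x)) | i j x. i \<in> I \<and> j \<in> I \<and> neighbors d K (fst i) (fst j) \<and> G i j \<and>
                               x \<in> geo_simplex (fst i \<inter> fst j)}"

definition glued_space :: "nat \<Rightarrow> 'v set set \<Rightarrow> ('v set \<times> 'l) set \<Rightarrow>
    ('v set \<times> 'l \<Rightarrow> 'v set \<times> 'l \<Rightarrow> bool) \<Rightarrow> (('v set \<times> 'l) \<times> ('v \<Rightarrow> real)) set topology" where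
  "glued_space d K I G =
     quotient_space (copies I) (generated_equiv (topspace (copies I)) (gluing d K I G))"

text \<open>The map induced by the projections \<open>((\<sigma>, l), x) \<mapsto> x\<close>; glued points have the same
  barycentric coordinates, so their class has exactly one image.\<close>

definition unfolding_map :: "(('v set \<times> 'l) \<times> ('v \<Rightarrow> real)) set \<Rightarrow> 'v \<Rightarrow> real" where
  "unfolding_map c = the_elem (snd ` c)"

lemma unfolding_map_class:
  assumes "i \<in> I" "x \<in> geo_simplex (fst i)"
  shows "unfolding_map (generated_equiv (topspace (copies I)) (gluing d K I G) `` {(i, x)}) = x"
proof -
  let ?A = "topspace (copies I)" and ?R = "gluing d K I G"
  have mem: "(j, y) \<in> ?A \<longleftrightarrow> j \<in> I \<and> y \<in> geo_simplex (fst j)" for j y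
    by (auto simp: copies_def)
  have int: "x \<in> geo_simplex \<sigma>" if x: "x \<in> geo_simplex (\<sigma> \<inter> \<tau>)" and "finite \<sigma>"
    for \<sigma> \<tau> :: "'a set" and x
  proof -
    have "sum x (\<sigma> \<inter> \<tau>) = sum x \<sigma>"
      using x \<open>finite \<sigma>\<close> by (intro sum.mono_neutral_left) (auto simp: geo_simplex_def)
    then show ?thesis using x by (auto simp: geo_simplex_def)
  qed
  have sub: "?R \<subseteq> ?A \<times> ?A"
  proof
    fix p assume "p \<in> ?R"
    then obtain i j x where p: "p = ((i, x), (j, x))" "i \<in> I" "j \<in> I"
        "neighbors d K (fst i) (fst j)" "x \<in> geo_simplex (fst i \<inter> fst j)"
      by (auto simp: gluing_def)
    then have "finite (fst i)" "finite (fst j)"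
      by (auto simp: neighbors_def facets_def intro: card_ge_0_finite)
    then have "x \<in> geo_simplex (fst i)" "x \<in> geo_simplex (fst j)"
      using int[of x "fst i" "fst j"] int[of x "fst j" "fst i"] p(5)
      by (simp_all add: Int_commute)
    then show "p \<in> ?A \<times> ?A" using p mem by auto
  qed
  let ?E = "{(p, q). p \<in> ?A \<and> q \<in> ?A \<and> snd p = snd q}"
  have "equiv ?A ?E"
    by (auto simp: equiv_def refl_on_def sym_def trans_def)
  moreover have "?R \<subseteq> ?E"
  proof
    fix q assume q: "q \<in> ?R"
    then have "snd (fst q) = snd (snd q)" by (auto simp: gluing_def)
    then show "q \<in> ?E" using q sub by auto
  qed
  ultimately have "generated_equiv ?A ?R \<subseteq> ?E"
    unfolding generated_equiv_def by blast
  moreover have "((i, x), (i, x)) \<in> generated_equiv ?A ?R"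
    using equiv_generated_equiv[OF sub] assms mem[of i x] by (simp add: equiv_def refl_on_def)
  ultimately have "snd ` (generated_equiv ?A ?R `` {(i, x)}) = {x}"
    by (intro equalityI subsetI) (auto intro!: image_eqI[of _ _ "(i, x)"])
  then show ?thesis
    by (simp add: unfolding_map_def)
qed

definition complete_unfolding :: "nat \<Rightarrow> 'v set set \<Rightarrow> 'v set \<Rightarrow> ('v \<Rightarrow> nat) \<Rightarrow>
    (('v set \<times> ('v \<Rightarrow> nat)) \<times> ('v \<Rightarrow> real)) set topology" where
  "complete_unfolding d K \<sigma>\<^sub>0 b\<^sub>0 =
     glued_space d K {(\<sigma>, b). \<sigma> \<in> facets d K \<and> admissible_coloring d K \<sigma>\<^sub>0 b\<^sub>0 \<sigma> b}
       (\<lambda>(\<sigma>, b) (\<tau>, c). \<forall>v\<in>\<sigma> \<inter> \<tau>. b v = c v)"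

definition partial_unfolding :: "nat \<Rightarrow> 'v set set \<Rightarrow>
    (('v set \<times> 'v) \<times> ('v \<Rightarrow> real)) set topology" where
  "partial_unfolding d K =
     glued_space d K {(\<sigma>, v). \<sigma> \<in> facets d K \<and> v \<in> \<sigma>}
       (\<lambda>(\<sigma>, v) (\<tau>, w). w = perspectivity \<sigma> \<tau> v)"

section \<open>Coverings\<close>

text \<open>The analogue of \<^const>\<open>covering_space\<close> for abstract topologies.\<close>

definition covering_map :: "'a topology \<Rightarrow> 'b topology \<Rightarrow> ('a \<Rightarrow> 'b) \<Rightarrow> bool" where
  "covering_map X Y p \<longleftrightarrow>
     continuous_map X Y p \<and> p ` topspace X = topspace Y \<and>
     (\<forall>y\<in>topspace Y. \<exists>T. y \<in> T \<and> openin Y T \<and>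
        (\<exists>\<V>. \<Union>\<V> = {x \<in> topspace X. p x \<in> T} \<and> (\<forall>U\<in>\<V>. openin X U) \<and> pairwise disjnt \<V> \<and>
             (\<forall>U\<in>\<V>. homeomorphic_map (subtopology X U) (subtopology Y T) p)))"

definition covering :: "'a topology \<Rightarrow> 'b topology \<Rightarrow> ('a \<Rightarrow> 'b) \<Rightarrow> bool" where
  "covering X Y p \<longleftrightarrow> covering_map X Y p \<and> connected_space X"

end

theory Submission
  imports Defs
begin

text \<open>
  Both unfoldings are glued from labelled copies of the facets, a copy of a facet and a neighboring
  facet determining one copy of the latter.  Following such choices along a closed facet path in
  the star of a face \<open>\<kappa>\<close> changes the label by the projectivity of the path.  If all these
  projectivities are trivial (\<open>trivial_holonomy\<close>), then the copies of the facets around \<open>\<kappa>\<close>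
  fall into classes that contain each facet through \<open>\<kappa>\<close> exactly once, each class is a
  \<open>sheet\<close> which the unfolding map sends homeomorphically onto the open star of \<open>\<kappa>\<close>, and these sheets are disjoint
  and open.  The open stars of the faces outside of the odd subcomplex cover its complement, so
  everything rests on

    \<^item> the local statement \<open>trivial_holonomy_off_odd\<close>: around a face that is not in the odd
      subcomplex, closed facet paths have trivial projectivities.

  It is proved by induction on the codimension of \<open>\<kappa>\<close>.  In codimension at most one there is no
  room for a non-trivial permutation.  In codimension two the two color classes of the link are
  preserved by every perspectivity.  In higher codimension the induction hypothesis trivializes
  the situation around every larger face \<open>\<kappa> \<union> {v}\<close>; the trivializations over the vertices
  \<open>v\<close> of the link of \<open>\<kappa>\<close> form a locally constant system on the link, and a locally constant
  system on a simply connected complex has no monodromy (\<open>trivial_monodromy\<close>).  The last fact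
  is the simplicial version of homotopy invariance: a null homotopy of an edge loop is
  cut into squares so small that each lies in the open star of a vertex, and the monodromy is
  transported square by square to the constant loop.

  The restricted coverings are connected because the odd subcomplex has codimension two: it meets
  neither the relative interior of a facet nor that of a ridge, so each facet remains connected
  after its removal, and neighboring copies still touch.  The components of the
  partial unfolding are the parts glued from the copies that are linked by a chain of gluings, and
  the complete unfolding consists of a single such part because every admissible coloring is
  obtained by propagating the base coloring along a facet path.
\<close>

section \<open>Supports of barycentric coordinates\<close>

definition carrier :: "('v \<Rightarrow> real) \<Rightarrow> 'v set" where
  "carrier x = {v. x v \<noteq> 0}"

lemma geo_simplex_carrier:
  assumes "x \<in> geo_simplex \<sigma>"
  shows "carrier x \<subseteq> \<sigma>" "carrier x \<noteq> {}"
proof -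
  show "carrier x \<subseteq> \<sigma>"
    using assms by (auto simp: geo_simplex_def carrier_def)
  show "carrier x \<noteq> {}"
  proof
    assume "carrier x = {}"
    then have "sum x \<sigma> = 0" by (intro sum.neutral) (auto simp: carrier_def)
    then show False using assms by (simp add: geo_simplex_def)
  qed
qed

lemma geo_simplex_iff_carrier:
  assumes "x \<in> geo_simplex \<tau>" "finite \<tau>" "finite \<sigma>"
  shows "x \<in> geo_simplex \<sigma> \<longleftrightarrow> carrier x \<subseteq> \<sigma>"
proof
  assume c: "carrier x \<subseteq> \<sigma>"
  have "sum x \<sigma> = sum x (carrier x)"
    using c assms by (intro sum.mono_neutral_right) (auto simp: carrier_def)
  also have "\<dots> = sum x \<tau>"
    using geo_simplex_carrier(1)[OF assms(1)] assms by (intro sum.mono_neutral_left) (auto simp: carrier_def)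
  finally have "sum x \<sigma> = 1" using assms(1) by (simp add: geo_simplex_def)
  moreover have "x v = 0" if "v \<notin> \<sigma>" for v using c that by (auto simp: carrier_def)
  moreover have "0 \<le> x v" for v using assms(1) by (simp add: geo_simplex_def)
  ultimately show "x \<in> geo_simplex \<sigma>" by (simp add: geo_simplex_def)
qed (rule geo_simplex_carrier)

lemma face_finite: "abstract_complex K \<Longrightarrow> \<sigma> \<in> K \<Longrightarrow> finite \<sigma>"
  and face_nonempty: "abstract_complex K \<Longrightarrow> \<sigma> \<in> K \<Longrightarrow> \<sigma> \<noteq> {}"
  and face_subset: "abstract_complex K \<Longrightarrow> \<sigma> \<in> K \<Longrightarrow> \<tau> \<subseteq> \<sigma> \<Longrightarrow> \<tau> \<noteq> {} \<Longrightarrow> \<tau> \<in> K"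
  unfolding abstract_complex_def by blast+

lemma polyhedron_carrier:
  assumes "abstract_complex K" "x \<in> polyhedron_of K"
  shows "carrier x \<in> K" "x \<in> geo_simplex (carrier x)"
proof -
  obtain \<sigma> where s: "\<sigma> \<in> K" "x \<in> geo_simplex \<sigma>"
    using assms by (auto simp: polyhedron_of_def)
  note c = geo_simplex_carrier[OF s(2)]
  show K: "carrier x \<in> K"
    using face_subset[OF assms(1) s(1) c] .
  show "x \<in> geo_simplex (carrier x)"
    by (simp add: geo_simplex_iff_carrier[OF s(2) face_finite[OF assms(1) s(1)] face_finite[OF assms(1) K]])
qed

lemma polyhedron_nonneg: "x \<in> polyhedron_of K \<Longrightarrow> 0 \<le> x v"
  unfolding polyhedron_of_def geo_simplex_def by blast

lemma carrier_iff_pos: "x \<in> polyhedron_of K \<Longrightarrow> v \<in> carrier x \<longleftrightarrow> 0 < x v"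
  using polyhedron_nonneg[of x K v] by (auto simp: carrier_def)

section \<open>Transport along edge paths of a simply connected complex\<close>

text \<open>The data of a locally constant system on a complex: fibres over the vertices, and transport
  along the edges which is consistent on each simplex.  Transport maps are total functions and are
  controlled on the fibres only.\<close>

locale vertex_transport =
  fixes L :: "'v set set" and P :: "'v \<Rightarrow> 's set" and tr :: "'v \<Rightarrow> 'v \<Rightarrow> 's \<Rightarrow> 's"
  assumes complex: "abstract_complex L"
    and tr_in: "{u, v} \<in> L \<Longrightarrow> s \<in> P u \<Longrightarrow> tr u v s \<in> P v"
    and tr_refl: "{v} \<in> L \<Longrightarrow> s \<in> P v \<Longrightarrow> tr v v s = s"
    and tr_tr: "{u, v, w} \<in> L \<Longrightarrow> s \<in> P u \<Longrightarrow> tr v w (tr u v s) = tr u w s"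
begin

primrec lift :: "(nat \<Rightarrow> 'v) \<Rightarrow> 's \<Rightarrow> nat \<Rightarrow> 's" where
  "lift a s 0 = s"
| "lift a s (Suc j) = tr (a j) (a (Suc j)) (lift a s j)"

text \<open>The walk need not be closed as a sequence; the last transport leads back from its end to its
  start.  The rows of a subdivided homotopy of loops are closed only in this sense.\<close>

definition monodromy :: "(nat \<Rightarrow> 'v) \<Rightarrow> nat \<Rightarrow> 's \<Rightarrow> 's" where
  "monodromy a n s = tr (a n) (a 0) (lift a s n)"

lemma in_L: "\<tau> \<in> L \<Longrightarrow> A \<subseteq> \<tau> \<Longrightarrow> A \<noteq> {} \<Longrightarrow> A \<in> L"
  using face_subset[OF complex] .

lemma lift_in:
  assumes "\<And>j. j < n \<Longrightarrow> {a j, a (Suc j)} \<in> L" "s \<in> P (a 0)"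
  shows "lift a s n \<in> P (a n)"
  using assms by (induction n) (auto intro: tr_in)

text \<open>Two walks that stay in common simplices step by step have the same transport, up to
  changing sides at both ends: each square of the ladder commutes by consistency on a simplex.\<close>

lemma lift_ladder:
  assumes "\<And>j. j < n \<Longrightarrow> {a j, a (Suc j), b j, b (Suc j)} \<in> L" "s \<in> P (a 0)"
  shows "lift b (tr (a 0) (b 0) s) n = tr (a n) (b n) (lift a s n)"
  using assms(1)
proof (induction n)
  case (Suc n)
  let ?X = "lift a s n"
  have q: "{a n, a (Suc n), b n, b (Suc n)} \<in> L" using Suc.prems by simp
  have e: "{a j, a (Suc j)} \<in> L" if "j < n" for j
    by (rule in_L[OF Suc.prems[of j]]) (use that in auto)
  have X: "?X \<in> P (a n)"
    using e assms(2) by (rule lift_in)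
  have "tr (b n) (b (Suc n)) (tr (a n) (b n) ?X) = tr (a n) (b (Suc n)) ?X"
    using X by (intro tr_tr in_L[OF q]) auto
  also have "\<dots> = tr (a (Suc n)) (b (Suc n)) (tr (a n) (a (Suc n)) ?X)"
    using X by (intro tr_tr[symmetric] in_L[OF q]) auto
  finally show ?case using Suc by simp
qed simp

text \<open>One step of the homotopy: moving sideways conjugates the monodromy, and the transport
  \<open>c\<close> to the other side is injective, as it can be undone.\<close>

lemma monodromy_ladder:
  assumes lad: "\<And>j. j < n \<Longrightarrow> {a j, a (Suc j), b j, b (Suc j)} \<in> L"
    and ends: "{a 0, a n, b 0, b n} \<in> L"
    and s: "s \<in> P (a 0)"
    and triv: "\<And>t. t \<in> P (b 0) \<Longrightarrow> monodromy b n t = t"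
  shows "monodromy a n s = s"
proof -
  let ?X = "lift a s n" and ?c = "tr (a 0) (b 0)"
  have X: "?X \<in> P (a n)"
  proof (rule lift_in)
    show "{a j, a (Suc j)} \<in> L" if "j < n" for j
      by (rule in_L[OF lad[OF that]]) auto
  qed (rule s)
  have c: "?c s \<in> P (b 0)"
    using s by (intro tr_in in_L[OF ends]) auto
  have mon: "monodromy a n s \<in> P (a 0)"
    unfolding monodromy_def using X by (intro tr_in in_L[OF ends]) auto
  have ret: "tr (b 0) (a 0) (?c t) = t" if "t \<in> P (a 0)" for t
  proof -
    have "tr (b 0) (a 0) (?c t) = tr (a 0) (a 0) t"
      using that by (intro tr_tr in_L[OF ends]) auto
    also have "\<dots> = t" using that by (intro tr_refl in_L[OF ends]) auto
    finally show ?thesis .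
  qed
  have "?c (monodromy a n s) = tr (a n) (b 0) ?X"
    unfolding monodromy_def using X by (intro tr_tr in_L[OF ends]) auto
  also have "\<dots> = tr (b n) (b 0) (tr (a n) (b n) ?X)"
    using X by (intro tr_tr[symmetric] in_L[OF ends]) auto
  also have "tr (a n) (b n) ?X = lift b (?c s) n"
    by (rule lift_ladder[symmetric]) (use lad s in auto)
  also have "tr (b n) (b 0) (lift b (?c s) n) = ?c s"
    using triv[OF c] by (simp add: monodromy_def)
  finally show ?thesis using ret[OF mon] ret[OF s] by metis
qed

lemma monodromy_in_simplex:
  assumes "\<tau> \<in> L" "\<And>j. j \<le> n \<Longrightarrow> a j \<in> \<tau>" "s \<in> P (a 0)"
  shows "monodromy a n s = s"
proof -
  have "lift a s n = tr (a 0) (a n) s"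
    using assms(2)
  proof (induction n)
    case 0
    then show ?case using tr_refl[OF in_L[OF assms(1)], of "a 0" s] assms(3) by simp
  next
    case (Suc n)
    then show ?case
      using tr_tr[of "a 0" "a n" "a (Suc n)" s] assms(3) by (simp add: in_L[OF assms(1)])
  qed
  moreover have "tr (a n) (a 0) (tr (a 0) (a n) s) = tr (a 0) (a 0) s"
    using assms by (intro tr_tr in_L[OF assms(1)]) auto
  moreover have "tr (a 0) (a 0) s = s"
    using assms by (intro tr_refl in_L[OF assms(1)]) auto
  ultimately show ?thesis by (simp add: monodromy_def)
qed

text \<open>Waiting \<open>m\<close> steps at each vertex does not change the transport.  This adapts an edge walk to
  the mesh of the grid.\<close>

lemma lift_stretch:
  assumes "\<And>k. k \<le> n \<Longrightarrow> {v k} \<in> L" "\<And>k. k < n \<Longrightarrow> {v k, v (Suc k)} \<in> L" "s \<in> P (v 0)" "j div m \<le> n"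
  shows "lift (\<lambda>j. v (j div m)) s j = lift v s (j div m)"
  using assms(4)
proof (induction j)
  case (Suc j)
  have le: "j div m \<le> Suc j div m" by (simp add: div_le_mono)
  have IH: "lift (\<lambda>j. v (j div m)) s j = lift v s (j div m)" using Suc le by simp
  show ?case
  proof (cases "Suc j mod m = 0")
    case True
    then show ?thesis using IH by (simp add: div_Suc)
  next
    case False
    then have "Suc j div m = j div m" by (simp add: div_Suc)
    moreover have "lift v s (j div m) \<in> P (v (j div m))"
      using Suc.prems le by (intro lift_in[OF assms(2,3)]) linarith
    ultimately show ?thesis using IH tr_refl[of "v (j div m)"] assms(1) Suc.prems by simp
  qed
qed simp

end

text \<open>The piecewise linear path through the vertices \<open>v 0, \<dots>, v n\<close>, at constant speed on
  \<open>{0..1}\<close>: the \<open>k\<close>-th visited vertex contributes a hat function centred at time \<open>k / n\<close>.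
  Summing over \<open>k\<close> allows a vertex to be visited repeatedly.\<close>

definition edge_path :: "nat \<Rightarrow> (nat \<Rightarrow> 'v) \<Rightarrow> real \<Rightarrow> 'v \<Rightarrow> real" where
  "edge_path n v t w = (\<Sum>k\<le>n. if v k = w then max 0 (1 - \<bar>t * real n - real k\<bar>) else 0)"

lemma continuous_edge_path: "continuous_on S (edge_path n v)"
  unfolding edge_path_def
  apply (rule continuous_on_coordinatewise_then_product)
  apply (intro continuous_on_sum)
  subgoal for w k by (cases "v k = w") (auto intro!: continuous_intros)
  done

lemma edge_path_segment:
  assumes k: "k < n" "real k \<le> t * real n" "t * real n \<le> real k + 1"
  shows "edge_path n v t \<in> geo_simplex {v k, v (Suc k)}"
proof -
  let ?r = "t * real n - real k"
  have "edge_path n v t w = (if v k = w then 1 - ?r else 0) + (if v (Suc k) = w then ?r else 0)" for w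
  proof -
    have "edge_path n v t w =
        (\<Sum>i\<in>{k, Suc k}. if v i = w then max 0 (1 - \<bar>t * real n - real i\<bar>) else 0)"
      unfolding edge_path_def
    proof (intro sum.mono_neutral_right ballI)
      fix i assume "i \<in> {..n} - {k, Suc k}"
      then have "i + 1 \<le> k \<or> k + 2 \<le> i" by auto
      then have "real i + 1 \<le> real k \<or> real k + 2 \<le> real i" by linarith
      then have "max 0 (1 - \<bar>t * real n - real i\<bar>) = 0" using k by linarith
      then show "(if v i = w then max 0 (1 - \<bar>t * real n - real i\<bar>) else 0) = 0" by simp
    qed (use k in auto)
    then show ?thesis using k by (auto simp: abs_if max_def)
  qed
  moreover have "sum (edge_path n v t) {v k, v (Suc k)} = 1"
    unfolding calculation by (cases "v k = v (Suc k)") auto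
  ultimately show ?thesis using k by (auto simp: geo_simplex_def)
qed

context vertex_transport
begin

text \<open>A null homotopy \<open>h\<close> of the edge loop exists by simple connectedness.  Each point of the square
  has a vertex \<open>c z\<close> such that \<open>h\<close> maps a whole neighborhood of \<open>z\<close>, of radius independent of
  \<open>z\<close>, into the open star of \<open>c z\<close>.  On a fine grid, the vertices chosen at the corners of a
  small square all belong to the carrier of one point, so they span a simplex, and consecutive
  rows form a ladder.  The top row lies in a single simplex; below the bottom row sits the given
  walk, stretched to the mesh of the grid.\<close>

theorem trivial_monodromy:
  assumes sc: "simply_connected (polyhedron_of L)"
    and v: "\<And>k. k < n \<Longrightarrow> {v k, v (Suc k)} \<in> L" "v n = v 0"
    and s: "s \<in> P (v 0)"
  shows "lift v s n = s"
proof (cases "n = 0")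
  case False
  then have n: "0 < n" by simp
  let ?p = "edge_path n v"
  have seg: "?p t \<in> polyhedron_of L" if "t \<in> {0..1}" for t
  proof -
    define k where "k = min (nat \<lfloor>t * real n\<rfloor>) (n - 1)"
    have t: "0 \<le> t * real n" "t * real n \<le> real n" using that by (auto intro: mult_left_le_one_le)
    have "k < n" using n by (auto simp: k_def)
    moreover have "real k \<le> t * real n" "t * real n \<le> real k + 1"
      using t n unfolding k_def by (auto simp: min_def of_nat_diff) linarith+
    ultimately show ?thesis
      using edge_path_segment v(1) by (fastforce simp: polyhedron_of_def)
  qed
  have ends: "?p 0 = ?p 1"
  proof
    fix w
    have 0: "edge_path n v 0 w = (\<Sum>k\<in>{0}. if v k = w then max 0 (1 - \<bar>0 - real k\<bar>) else 0)"
      unfolding edge_path_def by (intro sum.mono_neutral_cong_right) auto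
    have 1: "edge_path n v 1 w = (\<Sum>k\<in>{n}. if v k = w then max 0 (1 - \<bar>real n - real k\<bar>) else 0)"
      unfolding edge_path_def by (intro sum.mono_neutral_cong_right) (auto simp: max_def abs_if)
    show "?p 0 w = ?p 1 w" using 0 1 v(2) by simp
  qed
  let ?c = "\<lambda>_::real. ?p 0"
  have "homotopic_loops (polyhedron_of L) ?p ?c"
  proof -
    have "path ?p" unfolding path_def by (rule continuous_edge_path)
    moreover have "path ?c" unfolding path_def by (rule continuous_on_const)
    ultimately show ?thesis
      using sc seg ends unfolding simply_connected_def pathfinish_def pathstart_def path_image_def
      by (smt (verit, best) atLeastAtMost_iff image_subsetI zero_le_one)
  qed
  then obtain h where
    hc: "continuous_on ({0..1::real} \<times> {0..1}) h" and
    hi: "h \<in> ({0..1} \<times> {0..1}) \<rightarrow> polyhedron_of L" and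
    h0: "\<And>x. x \<in> {0..1} \<Longrightarrow> h (0, x) = ?p x" and
    h1: "\<And>x. x \<in> {0..1} \<Longrightarrow> h (1, x) = ?p 0" and
    hl: "\<And>t. t \<in> {0..1} \<Longrightarrow> h (t, 1) = h (t, 0)"
    unfolding homotopic_loops by (auto simp: pathfinish_def pathstart_def)
  let ?S = "{0..1::real} \<times> {0..1::real}"
  define \<G> where "\<G> = {G. open G \<and> (\<exists>w. \<forall>z\<in>G \<inter> ?S. 0 < h z w)}"
  have cover: "?S \<subseteq> \<Union>\<G>"
  proof
    fix z assume z: "z \<in> ?S"
    then have hz: "h z \<in> polyhedron_of L" using hi by auto
    then have "carrier (h z) \<noteq> {}"
      using polyhedron_carrier(1)[OF complex] face_nonempty[OF complex] by blast
    then obtain w where w: "0 < h z w" using carrier_iff_pos[OF hz] by blast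
    have "continuous_on ?S (\<lambda>z. h z w)"
      using hc by (rule continuous_on_product_then_coordinatewise)
    then have "openin (top_of_set ?S) (?S \<inter> (\<lambda>z. h z w) -` {0<..})"
      by (rule continuous_openin_preimage_gen) simp
    then obtain G where "open G" "?S \<inter> (\<lambda>z. h z w) -` {0<..} = ?S \<inter> G"
      by (auto simp: openin_open)
    then show "z \<in> \<Union>\<G>" using z w unfolding \<G>_def by blast
  qed
  have "compact ?S" by (intro compact_Times) auto
  then obtain \<delta> where \<delta>: "0 < \<delta>" "\<And>z. z \<in> ?S \<Longrightarrow> \<exists>G\<in>\<G>. ball z \<delta> \<subseteq> G"
    using Heine_Borel_lemma[OF _ cover] by (metis (mono_tags, lifting) \<G>_def mem_Collect_eq)
  then have "\<exists>w. \<forall>z'\<in>?S. dist z z' < \<delta> \<longrightarrow> 0 < h z' w" if "z \<in> ?S" for z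
    using that unfolding \<G>_def by (fastforce simp: subset_iff)
  then obtain c where c: "\<And>z z'. z \<in> ?S \<Longrightarrow> z' \<in> ?S \<Longrightarrow> dist z z' < \<delta> \<Longrightarrow> 0 < h z' (c z)"
    by metis
  obtain m :: nat where m: "2 / \<delta> < real m" using reals_Archimedean2 by blast
  have m0: "0 < m" using m \<delta>(1) by (metis divide_pos_pos gr0I of_nat_0 order_less_asym zero_less_numeral)
  define N where "N = n * m"
  have N: "m \<le> N" "0 < N" using n m0 by (auto simp: N_def)
  have "2 / \<delta> < real N" using m N(1) by linarith
  then have mesh: "2 / real N < \<delta>" using \<delta>(1) N(2) by (simp add: field_simps)
  define z :: "nat \<Rightarrow> nat \<Rightarrow> real \<times> real" where "z = (\<lambda>i j. (real i / real N, real j / real N))"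
  define a where "a = (\<lambda>i j. c (z i j))"
  have zS: "z i j \<in> ?S" if "i \<le> N" "j \<le> N" for i j
    using that N(2) by (auto simp: z_def)
  \<comment> \<open>the choices at the upper and right neighbors of a grid point are still good at that point\<close>
  have near: "0 < h (z i j) (a i' j')"
    if "i \<le> N" "j \<le> N" "i' \<le> N" "j' \<le> N" "i' \<in> {i, Suc i}" "j' \<in> {j, Suc j}" for i j i' j'
  proof -
    have 1: "dist (real a / real N) (real b / real N) \<le> 1 / real N" if "a \<in> {b, Suc b}" for a b
      using that N(2) by (auto simp: dist_real_def divide_simps)
    have "dist (z i' j') (z i j) \<le> dist (real i' / real N) (real i / real N) + dist (real j' / real N) (real j / real N)"
      unfolding z_def dist_Pair_Pair by (rule sqrt_sum_squares_le_sum) auto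
    also have "\<dots> \<le> 1 / real N + 1 / real N" using that by (intro add_mono 1) auto
    also have "\<dots> < \<delta>" using mesh by simp
    finally show ?thesis unfolding a_def using that by (intro c zS) auto
  qed
  have car: "A \<subseteq> carrier (h y)" if "y \<in> ?S" "\<And>w. w \<in> A \<Longrightarrow> 0 < h y w" for A y
    using that(2) by (fastforce simp: carrier_def)
  have simplex: "A \<in> L" if y: "y \<in> ?S" and "A \<noteq> {}" "\<And>w. w \<in> A \<Longrightarrow> 0 < h y w" for A y
  proof (rule in_L)
    show "carrier (h y) \<in> L" using y hi by (blast intro: polyhedron_carrier(1)[OF complex])
    show "A \<subseteq> carrier (h y)" by (rule car[OF y]) (fact that(3))
  qed (fact that(2))
  have square: "{a i j, a i (Suc j), a i' j, a i' (Suc j)} \<in> L"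
    if "i < N" "j < N" "i' = Suc i" for i j i'
    using that by (intro simplex[OF zS[of i j]]) (auto intro!: near)
  \<comment> \<open>the left and the right edge of the square have the same image, which closes up each row\<close>
  have wrap: "z i 0 \<in> ?S" "h (z i N) = h (z i 0)" if "i \<le> N" for i
    using that hl[of "real i / real N"] N(2) zS[of i 0] by (auto simp: z_def)
  have "monodromy (a i) N t = t" if "i \<le> N" "t \<in> P (a i 0)" for i t
    using that
  proof (induction i arbitrary: t rule: inc_induct)
    case base
    have "h (z N j) = ?p 0" if "j \<le> N" for j
      using that h1[of "real j / real N"] N(2) by (auto simp: z_def)
    then have "a N j \<in> carrier (?p 0)" if "j \<le> N" for j
      using near[of N j N j] that by (auto simp: carrier_def)
    moreover have "carrier (?p 0) \<in> L"
      using polyhedron_carrier(1)[OF complex] seg by simp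
    ultimately show ?case using base by (intro monodromy_in_simplex) auto
  next
    case (step i)
    have e: "{a i 0, a i N, a (Suc i) 0, a (Suc i) N} \<in> L"
    proof (rule simplex[OF wrap(1)[of i]])
      have "0 < h (z i N) (a i N)" "0 < h (z i N) (a (Suc i) N)"
        "0 < h (z i 0) (a i 0)" "0 < h (z i 0) (a (Suc i) 0)"
        using step.hyps by (auto intro!: near)
      then show "0 < h (z i 0) w" if "w \<in> {a i 0, a i N, a (Suc i) 0, a (Suc i) N}" for w
        using that wrap(2)[of i] step.hyps by auto
    qed (use step.hyps in auto)
    show ?case
      by (rule monodromy_ladder[where b = "a (Suc i)"])
        (use step e square[of i] in auto)
  qed
  note rows = this[of 0]
  let ?b = "\<lambda>j. v (j div m)"
  \<comment> \<open>on the bottom edge \<open>h\<close> is the edge path, so the choices made there are vertices of its edges\<close>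
  have bseg: "A \<subseteq> {v k, v (Suc k)}"
    if "j \<le> N" "k < n" "k * m \<le> j" "j \<le> Suc k * m" "\<And>w. w \<in> A \<Longrightarrow> 0 < h (z 0 j) w" for A j k
  proof -
    let ?t = "real j / real N"
    have t: "?t * real n = real j / real m" using n m0 by (simp add: N_def)
    have "?t \<in> {0..1}" using that(1) N(2) by auto
    then have h: "h (z 0 j) = ?p ?t" using h0 by (simp add: z_def)
    have "real (k * m) \<le> real j" "real j \<le> real (Suc k * m)" using that by (simp_all only: of_nat_le_iff)
    then have "real k \<le> ?t * real n" "?t * real n \<le> real k + 1"
      unfolding t using m0 by (simp_all add: field_simps)
    then have "carrier (h (z 0 j)) \<subseteq> {v k, v (Suc k)}"
      using geo_simplex_carrier(1) edge_path_segment[OF that(2)] h by metis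
    then show ?thesis using car[OF zS[of 0 j]] that by blast
  qed
  have lad: "{?b j, ?b (Suc j), a 0 j, a 0 (Suc j)} \<in> L" if j: "j < N" for j
  proof -
    let ?k = "j div m"
    have k: "?k < n" using j m0 by (simp add: N_def less_mult_imp_div_less)
    have 1: "?k * m \<le> j" "?k * m \<le> Suc j" "Suc j \<le> Suc ?k * m"
      using m0 dividend_less_div_times[of m j] by (auto simp: Suc_le_eq intro: le_SucI)
    have "{a 0 j} \<subseteq> {v ?k, v (Suc ?k)}"
      by (rule bseg[of j]) (use j k 1 near[of 0 j 0 j] in auto)
    moreover have "{a 0 (Suc j)} \<subseteq> {v ?k, v (Suc ?k)}"
      by (rule bseg[of "Suc j"]) (use j k 1 near[of 0 "Suc j" 0 "Suc j"] in auto)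
    moreover have "?b (Suc j) \<in> {v ?k, v (Suc ?k)}" by (simp add: div_Suc)
    ultimately show ?thesis using in_L[OF v(1)[OF k]] by simp
  qed
  have bN: "?b N = v 0" using m0 v(2) by (simp add: N_def)
  have "{a 0 0, a 0 N} \<subseteq> {v 0, v (Suc 0)}"
    by (rule bseg[of 0]) (use n wrap[of 0] near[of 0 0 0 0] near[of 0 N 0 N] in auto)
  then have e: "{?b 0, ?b N, a 0 0, a 0 N} \<in> L" using in_L[OF v(1)[OF n]] bN by simp
  have "monodromy ?b N s = s"
    by (rule monodromy_ladder[where b = "a 0"]) (use lad e rows s in auto)
  moreover have vL: "{v k} \<in> L" if "k \<le> n" for k
  proof (cases "k = n")
    case True
    then show ?thesis using in_L[OF v(1)[OF n]] v(2) by simp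
  next
    case False
    then show ?thesis using in_L[OF v(1)[of k]] that by simp
  qed
  moreover have "lift ?b s N = lift v s n"
    using lift_stretch[of n v s N m] vL v(1) s m0 by (simp add: N_def)
  moreover have "lift v s n \<in> P (v n)" using v s by (intro lift_in) auto
  ultimately show ?thesis using bN v(2) tr_refl[of "v 0"] by (simp add: monodromy_def)
qed simp

end

section \<open>Perspectivities around a face\<close>

text \<open>Projectivities along facet paths are followed one vertex at a time: the pair of a facet and one
  of its vertices moves to a neighboring facet and the image of the vertex.  The face \<open>\<kappa>\<close> confines
  the path to the star of \<open>\<kappa>\<close>.\<close>

definition perspectivity_step ::
    "nat \<Rightarrow> 'v set set \<Rightarrow> 'v set \<Rightarrow> 'v set \<times> 'v \<Rightarrow> 'v set \<times> 'v \<Rightarrow> bool" where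
  "perspectivity_step d K \<kappa> = (\<lambda>(\<sigma>, x) (\<tau>, y).
     neighbors d K \<sigma> \<tau> \<and> \<kappa> \<subseteq> \<sigma> \<inter> \<tau> \<and> x \<in> \<sigma> \<and> y = perspectivity \<sigma> \<tau> x)"

definition trivial_holonomy :: "nat \<Rightarrow> 'v set set \<Rightarrow> 'v set \<Rightarrow> bool" where
  "trivial_holonomy d K \<kappa> \<longleftrightarrow>
     (\<forall>\<sigma> x y. (perspectivity_step d K \<kappa>)\<^sup>*\<^sup>* (\<sigma>, x) (\<sigma>, y) \<longrightarrow> x = y)"

lemma neighborsE:
  assumes "neighbors d K \<sigma> \<tau>"
  obtains a b \<rho> where "\<sigma> = insert a \<rho>" "\<tau> = insert b \<rho>" "a \<notin> \<rho>" "b \<notin> \<rho>" "a \<noteq> b"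
    "\<rho> = \<sigma> \<inter> \<tau>" "\<rho> \<in> K" "card \<rho> = d" "finite \<rho>"
proof -
  obtain \<rho> where s: "card \<sigma> = d + 1" "card \<tau> = d + 1" "\<sigma> \<noteq> \<tau>"
    and r: "\<rho> \<in> K" "codim d \<rho> = 1" "\<rho> \<subseteq> \<sigma>" "\<rho> \<subseteq> \<tau>"
    using assms by (auto simp: neighbors_def facets_def ridges_def)
  have f: "finite \<sigma>" "finite \<tau>" using s by (auto intro: card_ge_0_finite)
  then have fr: "finite \<rho>" using r(3) finite_subset by blast
  have c: "card \<rho> = d" using r(2) by (simp add: codim_def)
  have "card (\<sigma> - \<rho>) = 1" "card (\<tau> - \<rho>) = 1"
    using s c r fr by (simp_all add: card_Diff_subset)
  then obtain a b where ab: "\<sigma> - \<rho> = {a}" "\<tau> - \<rho> = {b}"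
    by (metis card_1_singletonE)
  then have 1: "\<sigma> = insert a \<rho>" "\<tau> = insert b \<rho>" "a \<notin> \<rho>" "b \<notin> \<rho>" using r by auto
  then have 2: "a \<noteq> b" using s(3) by auto
  then have "\<rho> = \<sigma> \<inter> \<tau>" using 1 by auto
  then show thesis using that 1 2 r(1) c fr by blast
qed

lemma neighbors_sym: "neighbors d K \<sigma> \<tau> \<Longrightarrow> neighbors d K \<tau> \<sigma>"
  by (auto simp: neighbors_def)

lemma perspectivity_fix: "x \<in> \<sigma> \<Longrightarrow> x \<in> \<tau> \<Longrightarrow> perspectivity \<sigma> \<tau> x = x"
  by (simp add: perspectivity_def)

lemma perspectivity_new:
  assumes "a \<notin> \<rho>" "b \<notin> \<rho>" "a \<noteq> b"
  shows "perspectivity (insert a \<rho>) (insert b \<rho>) a = b"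
proof -
  have "(THE w. w \<in> insert b \<rho> - insert a \<rho>) = b"
    using assms by (intro the_equality) auto
  then show ?thesis using assms by (simp add: perspectivity_def)
qed

lemma perspectivity_in: "neighbors d K \<sigma> \<tau> \<Longrightarrow> x \<in> \<sigma> \<Longrightarrow> perspectivity \<sigma> \<tau> x \<in> \<tau>"
  by (elim neighborsE) (metis insertE insertI1 insertI2 perspectivity_fix perspectivity_new)

lemma perspectivity_inverse:
  assumes n: "neighbors d K \<sigma> \<tau>" and x: "x \<in> \<sigma>"
  shows "perspectivity \<tau> \<sigma> (perspectivity \<sigma> \<tau> x) = x"
proof -
  obtain a b \<rho> where e: "\<sigma> = insert a \<rho>" "\<tau> = insert b \<rho>" "a \<notin> \<rho>" "b \<notin> \<rho>" "a \<noteq> b"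
    using n by (rule neighborsE)
  show ?thesis
  proof (cases "x = a")
    case True
    then show ?thesis using e perspectivity_new[of a \<rho> b] perspectivity_new[of b \<rho> a] by simp
  next
    case False
    then show ?thesis using x e by (simp add: perspectivity_fix)
  qed
qed

text \<open>For colorings of neighboring facets with the same set of colors, agreeing on the common ridge
  forces agreement of the two remaining vertices.  This turns the gluing rule of the
  complete unfolding into propagation along perspectivities.\<close>

lemma perspectivity_eq_iff_ridge:
  assumes n: "neighbors d K \<sigma> \<tau>" and b: "bij_betw b \<sigma> S" and c: "bij_betw c \<tau> S"
  shows "(\<forall>x\<in>\<sigma>. c (perspectivity \<sigma> \<tau> x) = b x) \<longleftrightarrow> (\<forall>v\<in>\<sigma> \<inter> \<tau>. b v = c v)"
proof -
  obtain u w \<rho> where e: "\<sigma> = insert u \<rho>" "\<tau> = insert w \<rho>" "u \<notin> \<rho>" "w \<notin> \<rho>" "u \<noteq> w" "\<rho> = \<sigma> \<inter> \<tau>"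
    using n by (rule neighborsE)
  have "c w = b u" if "\<forall>v\<in>\<rho>. b v = c v"
  proof -
    have "b ` \<rho> = c ` \<rho>" using that by simp
    moreover have "b ` \<sigma> = c ` \<tau>" using b c by (simp add: bij_betw_def)
    moreover have "b u \<notin> b ` \<rho>" "c w \<notin> c ` \<rho>"
      using b c e(1-4) by (auto simp: bij_betw_def)
    ultimately show ?thesis using e(1,2) by auto
  qed
  moreover have "perspectivity \<sigma> \<tau> u = w" using perspectivity_new[OF e(3-5)] e(1,2) by simp
  moreover have "perspectivity \<sigma> \<tau> x = x" if "x \<in> \<rho>" for x
    using that e(1,2) by (simp add: perspectivity_fix)
  ultimately show ?thesis unfolding e(6)[symmetric] using e(1) by auto
qed

lemma step_sym: "perspectivity_step d K \<kappa> z z' \<Longrightarrow> perspectivity_step d K \<kappa> z' z"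
  by (cases z; cases z')
    (auto simp: perspectivity_step_def perspectivity_inverse perspectivity_in intro: neighbors_sym)

lemma steps_sym: "(perspectivity_step d K \<kappa>)\<^sup>*\<^sup>* z z' \<Longrightarrow> (perspectivity_step d K \<kappa>)\<^sup>*\<^sup>* z' z"
  by (induction rule: rtranclp_induct) (auto intro: step_sym converse_rtranclp_into_rtranclp)

lemma steps_mono:
  assumes "(perspectivity_step d K \<kappa>)\<^sup>*\<^sup>* z z'" "\<kappa>' \<subseteq> \<kappa>"
  shows "(perspectivity_step d K \<kappa>')\<^sup>*\<^sup>* z z'"
proof -
  have "perspectivity_step d K \<kappa> \<le> perspectivity_step d K \<kappa>'"
    using assms(2) by (auto simp: perspectivity_step_def)
  then show ?thesis using rtranclp_mono assms(1) by blast
qed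

definition flags :: "nat \<Rightarrow> 'v set set \<Rightarrow> 'v set \<Rightarrow> ('v set \<times> 'v) set" where
  "flags d K \<kappa> = {(\<sigma>, x). \<sigma> \<in> facets d K \<and> \<kappa> \<subseteq> \<sigma> \<and> x \<in> \<sigma>}"

lemma step_flags:
  assumes "perspectivity_step d K \<kappa> z z'"
  shows "z \<in> flags d K \<kappa>" "z' \<in> flags d K \<kappa>"
proof -
  obtain \<sigma> x \<tau> y where z: "z = (\<sigma>, x)" "z' = (\<tau>, y)" by (metis surj_pair)
  have n: "neighbors d K \<sigma> \<tau>" "\<kappa> \<subseteq> \<sigma>" "\<kappa> \<subseteq> \<tau>" "x \<in> \<sigma>" "y = perspectivity \<sigma> \<tau> x"
    using assms z by (auto simp: perspectivity_step_def)
  have "y \<in> \<tau>" using perspectivity_in[OF n(1,4)] n(5) by simp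
  moreover have "\<sigma> \<in> facets d K" "\<tau> \<in> facets d K" using n(1) by (simp_all add: neighbors_def)
  ultimately show "z \<in> flags d K \<kappa>" "z' \<in> flags d K \<kappa>" using n z by (simp_all add: flags_def)
qed

lemma steps_flags:
  "(perspectivity_step d K \<kappa>)\<^sup>*\<^sup>* z z' \<Longrightarrow> z \<in> flags d K \<kappa> \<Longrightarrow> z' \<in> flags d K \<kappa>"
  by (induction rule: rtranclp_induct) (auto dest: step_flags(2))

lemma steps_flags_or_eq:
  "(perspectivity_step d K \<kappa>)\<^sup>*\<^sup>* z z' \<Longrightarrow> z \<noteq> z' \<Longrightarrow> z \<in> flags d K \<kappa> \<and> z' \<in> flags d K \<kappa>"
  by (metis converse_rtranclpE step_flags(1) steps_flags)

lemma steps_fix: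
  "(perspectivity_step d K \<kappa>)\<^sup>*\<^sup>* z z' \<Longrightarrow> snd z \<in> \<kappa> \<Longrightarrow> snd z' = snd z"
proof (induction rule: rtranclp_induct)
  case (step y z)
  then show ?case by (auto simp: perspectivity_step_def intro!: perspectivity_fix)
qed simp

definition neighbors_around :: "nat \<Rightarrow> 'v set set \<Rightarrow> 'v set \<Rightarrow> 'v set \<Rightarrow> 'v set \<Rightarrow> bool" where
  "neighbors_around d K \<kappa> \<sigma> \<tau> \<longleftrightarrow> neighbors d K \<sigma> \<tau> \<and> \<kappa> \<subseteq> \<sigma> \<inter> \<tau>"

lemma successively_imp_rtranclp:
  "successively R \<gamma> \<Longrightarrow> \<gamma> \<noteq> [] \<Longrightarrow> R\<^sup>*\<^sup>* (hd \<gamma>) (last \<gamma>)"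
proof (induction \<gamma> rule: induct_list012)
  case (3 x y zs)
  then show ?case by (auto intro: converse_rtranclp_into_rtranclp)
qed auto

lemma steps_along_facets:
  assumes "(neighbors_around d K \<kappa>)\<^sup>*\<^sup>* \<sigma> \<tau>" "x \<in> \<sigma>"
  shows "\<exists>y\<in>\<tau>. (perspectivity_step d K \<kappa>)\<^sup>*\<^sup>* (\<sigma>, x) (\<tau>, y)"
  using assms
proof (induction rule: rtranclp_induct)
  case (step \<tau> \<upsilon>)
  then obtain y where y: "y \<in> \<tau>" "(perspectivity_step d K \<kappa>)\<^sup>*\<^sup>* (\<sigma>, x) (\<tau>, y)" by blast
  then have "perspectivity_step d K \<kappa> (\<tau>, y) (\<upsilon>, perspectivity \<tau> \<upsilon> y)"
    using step.hyps by (simp add: perspectivity_step_def neighbors_around_def)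
  then show ?case
    using y step.hyps by (meson neighbors_around_def perspectivity_in rtranclp.rtrancl_into_rtrancl)
qed blast

locale nice_simplicial_complex =
  fixes d :: nat and K :: "'v set set"
  assumes complex: "abstract_complex K"
    and locally_finite: "locally_finite_complex K"
    and pure: "pure_complex d K"
    and strong: "strongly_connected d K"
    and nice: "nice_complex d K"
begin

abbreviation step where "step \<equiv> perspectivity_step d K"

lemma facet_in: "\<sigma> \<in> facets d K \<Longrightarrow> \<sigma> \<in> K"
  by (simp add: facets_def)

lemma facet_finite: "\<sigma> \<in> facets d K \<Longrightarrow> finite \<sigma>"
  using face_finite[OF complex] facet_in .

lemma facet_containing: "\<kappa> \<in> K \<Longrightarrow> \<exists>\<sigma>\<in>facets d K. \<kappa> \<subseteq> \<sigma>"
  using pure by (simp add: pure_complex_def)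

lemma facet_maximal:
  assumes "\<sigma> \<in> facets d K" "\<sigma> \<subseteq> \<tau>" "\<tau> \<in> K"
  shows "\<tau> = \<sigma>"
proof -
  obtain \<upsilon> where u: "\<upsilon> \<in> facets d K" "\<tau> \<subseteq> \<upsilon>" using facet_containing[OF assms(3)] by blast
  then have "\<sigma> = \<upsilon>"
    using assms facet_finite[OF u(1)] by (intro card_subset_eq) (auto simp: facets_def)
  then show ?thesis using u assms by auto
qed

text \<open>The star of \<open>\<kappa>\<close> also contains faces that do not contain \<open>\<kappa>\<close>, but by purity its facets are
  exactly the facets of the complex through \<open>\<kappa>\<close>.\<close>

lemma facets_around_connected:
  assumes \<kappa>: "\<kappa> \<in> K" and s: "\<sigma> \<in> facets d K" "\<kappa> \<subseteq> \<sigma>" and t: "\<tau> \<in> facets d K" "\<kappa> \<subseteq> \<tau>"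
  shows "(neighbors_around d K \<kappa>)\<^sup>*\<^sup>* \<sigma> \<tau>"
proof -
  have sc: "strongly_connected d (star K \<kappa>)"
    using nice \<kappa> by (simp add: nice_complex_def locally_strongly_connected_def)
  have "\<sigma> \<in> facets d (star K \<kappa>)" "\<tau> \<in> facets d (star K \<kappa>)"
    using s t by (auto simp: facets_def star_def)
  then obtain \<gamma> where \<gamma>: "facet_path d (star K \<kappa>) \<gamma>" "hd \<gamma> = \<sigma>" "last \<gamma> = \<tau>"
    using sc unfolding strongly_connected_def by blast
  have "\<kappa> \<subseteq> \<upsilon>" if u: "\<upsilon> \<in> facets d (star K \<kappa>)" for \<upsilon>
  proof -
    obtain \<omega> where "\<omega> \<in> K" "\<kappa> \<subseteq> \<omega>" "\<upsilon> \<subseteq> \<omega>" using u unfolding facets_def star_def by blast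
    moreover have "\<upsilon> \<in> facets d K" using u by (simp add: facets_def star_def)
    ultimately show ?thesis using facet_maximal by blast
  qed
  moreover have "facets d (star K \<kappa>) \<subseteq> facets d K" "ridges d (star K \<kappa>) \<subseteq> ridges d K"
    unfolding facets_def ridges_def star_def by blast+
  ultimately have "neighbors_around d K \<kappa> \<upsilon> \<upsilon>'" if "neighbors d (star K \<kappa>) \<upsilon> \<upsilon>'" for \<upsilon> \<upsilon>'
    using that unfolding neighbors_around_def neighbors_def by blast
  moreover have "(neighbors d (star K \<kappa>))\<^sup>*\<^sup>* \<sigma> \<tau>"
    using successively_imp_rtranclp[of "neighbors d (star K \<kappa>)" \<gamma>] \<gamma> unfolding facet_path_def by simp
  ultimately show ?thesis using mono_rtranclp[of "neighbors d (star K \<kappa>)" "neighbors_around d K \<kappa>"] by blast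
qed

lemma steps_to_facet:
  assumes "\<kappa> \<in> K" "z \<in> flags d K \<kappa>" "\<tau> \<in> facets d K" "\<kappa> \<subseteq> \<tau>"
  obtains y where "y \<in> \<tau>" "(step \<kappa>)\<^sup>*\<^sup>* z (\<tau>, y)"
proof (cases z)
  case (Pair \<sigma> x)
  then have "\<sigma> \<in> facets d K" "\<kappa> \<subseteq> \<sigma>" "x \<in> \<sigma>" using assms(2) by (simp_all add: flags_def)
  then obtain y where "y \<in> \<tau>" "(step \<kappa>)\<^sup>*\<^sup>* (\<sigma>, x) (\<tau>, y)"
    using steps_along_facets[OF facets_around_connected[OF assms(1) _ _ assms(3,4)]] by blast
  then show thesis using that Pair by simp
qed

text \<open>The vertices of \<open>\<kappa>\<close> are fixed, and at most one vertex of a facet through \<open>\<kappa>\<close> is left.\<close>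

lemma trivial_holonomy_codim_le_1:
  assumes "\<kappa> \<in> K" "codim d \<kappa> \<le> 1"
  shows "trivial_holonomy d K \<kappa>"
  unfolding trivial_holonomy_def
proof (intro allI impI, rule ccontr)
  fix \<sigma> x y assume st: "(step \<kappa>)\<^sup>*\<^sup>* (\<sigma>, x) (\<sigma>, y)" and ne: "x \<noteq> y"
  have \<sigma>: "(\<sigma>, x) \<in> flags d K \<kappa>" and y: "(\<sigma>, y) \<in> flags d K \<kappa>"
    using steps_flags_or_eq[OF st] ne by auto
  have "x \<notin> \<kappa>" "y \<notin> \<kappa>"
    using steps_fix[OF st] steps_fix[OF steps_sym[OF st]] ne by auto
  then have "{x, y} \<subseteq> \<sigma> - \<kappa>" using \<sigma> y by (simp add: flags_def)
  moreover have s: "finite \<sigma>" "\<kappa> \<subseteq> \<sigma>" "card \<sigma> = d + 1"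
    using \<sigma> facet_finite[of \<sigma>] by (simp_all add: flags_def) (simp add: facets_def)
  ultimately have "card {x, y} \<le> card (\<sigma> - \<kappa>)" by (meson card_mono finite_Diff)
  moreover have "card (\<sigma> - \<kappa>) \<le> 1"
    using s(3) assms(2) card_Diff_subset[OF finite_subset[OF s(2,1)] s(2)] by (simp add: codim_def)
  ultimately show False using ne by simp
qed

text \<open>A facet through \<open>\<kappa>\<close> has exactly one vertex in each of the color classes of the link, and a
  perspectivity fixes one of the two; so it preserves the classes, and a closed path cannot
  exchange the two vertices.\<close>

lemma trivial_holonomy_bipartite:
  assumes \<kappa>: "\<kappa> \<in> K" "codim d \<kappa> = 2" and bip: "bipartite_graph (link K \<kappa>)"
  shows "trivial_holonomy d K \<kappa>"
proof -
  obtain A B where AB: "A \<inter> B = {}" "\<forall>e\<in>link K \<kappa>. card e = 2 \<longrightarrow> (\<exists>a\<in>A. \<exists>b\<in>B. e = {a, b})"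
    using bip unfolding bipartite_graph_def by (elim exE conjE)
  have edge: "\<exists>a b. \<sigma> - \<kappa> = {a, b} \<and> a \<in> A \<and> b \<notin> A" if \<sigma>: "\<sigma> \<in> facets d K" "\<kappa> \<subseteq> \<sigma>" for \<sigma>
  proof -
    have c: "card (\<sigma> - \<kappa>) = 2"
      using \<sigma> \<kappa>(2) card_Diff_subset[OF finite_subset[OF \<sigma>(2) facet_finite[OF \<sigma>(1)]] \<sigma>(2)]
      by (simp add: codim_def facets_def)
    then have "\<sigma> - \<kappa> \<noteq> {}" by (metis card.empty zero_neq_numeral)
    then have "\<sigma> - \<kappa> \<in> K" using face_subset[OF complex facet_in[OF \<sigma>(1)]] by blast
    moreover have "\<sigma> - \<kappa> \<union> \<kappa> = \<sigma>" using \<sigma>(2) by blast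
    ultimately have "\<sigma> - \<kappa> \<in> link K \<kappa>" using facet_in[OF \<sigma>(1)] unfolding link_def by auto
    then obtain a b where "a \<in> A" "b \<in> B" "\<sigma> - \<kappa> = {a, b}" using AB(2) c by meson
    then show ?thesis using AB(1) by blast
  qed
  have one: "snd z' \<in> A \<longleftrightarrow> snd z \<in> A" if "step \<kappa> z z'" and nk: "snd z \<notin> \<kappa>" for z z'
  proof -
    obtain \<sigma> x \<tau> y where z: "z = (\<sigma>, x)" "z' = (\<tau>, y)" by (metis surj_pair)
    have n: "neighbors d K \<sigma> \<tau>" "\<kappa> \<subseteq> \<sigma>" "\<kappa> \<subseteq> \<tau>" "x \<in> \<sigma>" "y = perspectivity \<sigma> \<tau> x"
      using that z by (auto simp: perspectivity_step_def)
    have F: "\<sigma> \<in> facets d K" "\<tau> \<in> facets d K" using n(1) by (auto simp: neighbors_def)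
    obtain a b \<rho> where e: "\<sigma> = insert a \<rho>" "\<tau> = insert b \<rho>" "a \<notin> \<rho>" "b \<notin> \<rho>" "a \<noteq> b" "\<rho> = \<sigma> \<inter> \<tau>"
      using n(1) by (rule neighborsE)
    show ?thesis
    proof (cases "x = a")
      case True
      then have y: "y = b" using perspectivity_new[OF e(3-5)] n(5) e(1,2) by simp
      have "\<kappa> \<subseteq> \<rho>" using n(2,3) e(6) by blast
      obtain p q where pq: "\<sigma> - \<kappa> = {p, q}" "p \<in> A" "q \<notin> A" using edge[OF F(1) n(2)] by blast
      obtain p' q' where pq': "\<tau> - \<kappa> = {p', q'}" "p' \<in> A" "q' \<notin> A" using edge[OF F(2) n(3)] by blast
      have s: "\<sigma> - \<kappa> = insert a (\<rho> - \<kappa>)" "\<tau> - \<kappa> = insert b (\<rho> - \<kappa>)"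
        using e(1-4) \<open>\<kappa> \<subseteq> \<rho>\<close> by auto
      have "a \<in> {p, q}" "b \<in> {p', q'}" unfolding pq(1)[symmetric] pq'(1)[symmetric] s by simp_all
      moreover have "\<rho> - \<kappa> = {p, q} - {a}" "\<rho> - \<kappa> = {p', q'} - {b}"
        unfolding pq(1)[symmetric] pq'(1)[symmetric] s using e(3,4) by simp_all
      \<comment> \<open>\<open>\<rho>\<close> contains exactly one further vertex, and each facet has exactly one in \<open>A\<close>\<close>
      ultimately have "a = p \<and> \<rho> - \<kappa> = {q} \<or> a = q \<and> \<rho> - \<kappa> = {p}"
        "b = p' \<and> \<rho> - \<kappa> = {q'} \<or> b = q' \<and> \<rho> - \<kappa> = {p'}"
        using pq(2,3) pq'(2,3) by blast+
      then have "a \<in> A \<longleftrightarrow> b \<in> A" using pq(2,3) pq'(2,3) by (metis singleton_inject)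
      then show ?thesis using True y z by simp
    next
      case False
      then have "y = x" using n(4,5) e(1,2) by (simp add: perspectivity_fix)
      then show ?thesis using z by simp
    qed
  qed
  have many: "snd z' \<in> A \<longleftrightarrow> snd z \<in> A" if "(step \<kappa>)\<^sup>*\<^sup>* z z'" "snd z \<notin> \<kappa>" for z z'
    using that
  proof (induction rule: rtranclp_induct)
    case (step u w)
    then have "snd u \<notin> \<kappa>" using steps_fix[OF steps_sym[OF step.hyps(1)]] by auto
    then show ?case using one[OF step.hyps(2)] step by simp
  qed simp
  show ?thesis
    unfolding trivial_holonomy_def
  proof (intro allI impI, rule ccontr)
    fix \<sigma> x y assume st: "(step \<kappa>)\<^sup>*\<^sup>* (\<sigma>, x) (\<sigma>, y)" and ne: "x \<noteq> y"
    have \<sigma>: "(\<sigma>, x) \<in> flags d K \<kappa>" and y: "(\<sigma>, y) \<in> flags d K \<kappa>"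
      using steps_flags_or_eq[OF st] ne by auto
    have nk: "x \<notin> \<kappa>" "y \<notin> \<kappa>"
      using steps_fix[OF st] steps_fix[OF steps_sym[OF st]] ne by auto
    then have "x \<in> \<sigma> - \<kappa>" "y \<in> \<sigma> - \<kappa>" using \<sigma> y by (auto simp: flags_def)
    moreover have "\<sigma> \<in> facets d K" "\<kappa> \<subseteq> \<sigma>" using \<sigma> by (simp_all add: flags_def)
    then obtain a b where ab: "\<sigma> - \<kappa> = {a, b}" "a \<in> A" "b \<notin> A" using edge by blast
    ultimately have "x \<in> {a, b}" "y \<in> {a, b}" by blast+
    then show False using many[OF st] nk ne ab(2,3) by auto
  qed
qed

lemma abstract_complex_link:
  assumes "\<kappa> \<in> K"
  shows "abstract_complex (link K \<kappa>)"
  unfolding abstract_complex_def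
proof (intro conjI ballI allI impI)
  fix \<tau> assume t: "\<tau> \<in> link K \<kappa>"
  then have K: "\<tau> \<in> K" "\<tau> \<inter> \<kappa> = {}" "\<tau> \<union> \<kappa> \<in> K" by (auto simp: link_def)
  show "finite \<tau>" "\<tau> \<noteq> {}" using face_finite[OF complex] face_nonempty[OF complex] K by auto
  fix \<tau>' assume t': "\<tau>' \<subseteq> \<tau> \<and> \<tau>' \<noteq> {}"
  then have "\<tau>' \<in> K" using face_subset[OF complex K(1)] by blast
  moreover have "\<tau>' \<union> \<kappa> \<in> K"
    by (rule face_subset[OF complex K(3)]) (use t' in auto)
  ultimately show "\<tau>' \<in> link K \<kappa>" using t' K(2) unfolding link_def by blast
qed

text \<open>The fibre over a vertex \<open>v\<close> of the link consists of the classes of pairs of a facet through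
  \<open>\<kappa> \<union> {v}\<close> and a vertex of it, under moving around \<open>\<kappa> \<union> {v}\<close>; by assumption such a class
  contains one vertex of each such facet.  Transport along an edge \<open>{u, v}\<close> restricts a class over
  \<open>u\<close> to the facets that also contain \<open>v\<close>, and takes the class over \<open>v\<close> of what remains.  Each
  simplex of the link lies in a facet, and a class represented over that facet is transported
  without changing the representative, whence consistency.  A closed facet path around \<open>\<kappa>\<close>
  crosses ridges that are strictly larger than \<open>\<kappa>\<close>; choosing a vertex of the link in each of them
  turns it into a closed edge walk, whose monodromy is the projectivity of the path.\<close>

lemma trivial_holonomy_simply_connected:
  assumes \<kappa>: "\<kappa> \<in> K" "codim d \<kappa> > 2" and sc: "simply_connected (polyhedron_of (link K \<kappa>))"
    and triv: "\<And>v. {v} \<in> link K \<kappa> \<Longrightarrow> trivial_holonomy d K (insert v \<kappa>)"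
  shows "trivial_holonomy d K \<kappa>"
proof -
  let ?L = "link K \<kappa>"
  define cls where "cls = (\<lambda>v z. {z'. (step (insert v \<kappa>))\<^sup>*\<^sup>* z z'})"
  define P where "P = (\<lambda>v. cls v ` flags d K (insert v \<kappa>))"
  define tr where "tr = (\<lambda>(u::'v) v C. {z'. \<exists>z\<in>C. v \<in> fst z \<and> (step (insert v \<kappa>))\<^sup>*\<^sup>* z z'})"
  note Lc = abstract_complex_link[OF \<kappa>(1)]
  have sub: "A \<in> ?L" if "\<tau> \<in> ?L" "A \<subseteq> \<tau>" "A \<noteq> {}" for A \<tau>
    using face_subset[OF Lc that] .
  have join: "A \<union> \<kappa> \<in> K" if "A \<in> ?L" for A using that by (simp add: link_def)
  have cls_eq: "cls v z = cls v z'" if "(step (insert v \<kappa>))\<^sup>*\<^sup>* z z'" for v z z'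
    unfolding cls_def using that steps_sym[OF that] by (auto intro: rtranclp_trans)
  have flags_iff: "z \<in> flags d K (insert v \<kappa>) \<longleftrightarrow> z \<in> flags d K \<kappa> \<and> v \<in> fst z" for v z
    by (cases z) (auto simp: flags_def)
  \<comment> \<open>two members of a class over \<open>u\<close> whose facets contain \<open>v\<close> are already linked around \<open>{u, v}\<close>:
    strong connectedness of that star provides a path, triviality over \<open>u\<close> its end\<close>
  have tr_cls: "tr u v (cls u z) = cls v z"
    if L: "{u, v} \<in> ?L" and z: "z \<in> flags d K \<kappa>" "u \<in> fst z" "v \<in> fst z" for u v z
  proof -
    have uvK: "insert u (insert v \<kappa>) \<in> K" using join[OF L] by simp
    have "(step (insert v \<kappa>))\<^sup>*\<^sup>* z z1"
      if st: "(step (insert u \<kappa>))\<^sup>*\<^sup>* z z1" and v: "v \<in> fst z1" for z1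
    proof -
      have z1: "z1 \<in> flags d K (insert u \<kappa>)" using steps_flags[OF st] flags_iff z by simp
      have zf: "z \<in> flags d K (insert u (insert v \<kappa>))" using z by (cases z) (auto simp: flags_def)
      have f: "fst z1 \<in> facets d K" "insert u (insert v \<kappa>) \<subseteq> fst z1"
        using z1 v by (cases z1; auto simp: flags_def)+
      obtain y where y: "(step (insert u (insert v \<kappa>)))\<^sup>*\<^sup>* z (fst z1, y)"
        using steps_to_facet[OF uvK zf f] by blast
      have "(step (insert u \<kappa>))\<^sup>*\<^sup>* z (fst z1, y)" by (rule steps_mono[OF y]) auto
      then have "(step (insert u \<kappa>))\<^sup>*\<^sup>* (fst z1, y) (fst z1, snd z1)"
        using st steps_sym by (metis prod.collapse rtranclp_trans)
      moreover have "{u} \<in> ?L" using sub[OF L] by simp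
      ultimately have "y = snd z1" using triv unfolding trivial_holonomy_def by blast
      then have "(step (insert u (insert v \<kappa>)))\<^sup>*\<^sup>* z z1" using y by simp
      then show ?thesis by (rule steps_mono) auto
    qed
    then show ?thesis
      unfolding tr_def cls_def using z(3) by (blast intro: rtranclp_trans)
  qed
  have rep: "\<exists>z. s = cls u z \<and> z \<in> flags d K \<kappa> \<and> A \<subseteq> fst z"
    if L: "A \<in> ?L" "u \<in> A" and s: "s \<in> P u" for u A s
  proof -
    obtain \<rho> where \<rho>: "\<rho> \<in> facets d K" "A \<union> \<kappa> \<subseteq> \<rho>" using facet_containing[OF join[OF L(1)]] by blast
    obtain z where z: "s = cls u z" "z \<in> flags d K (insert u \<kappa>)" using s unfolding P_def by blast
    have "{u} \<in> ?L" using sub[OF L(1)] L(2) by simp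
    then have uK: "insert u \<kappa> \<in> K" using join by fastforce
    have "insert u \<kappa> \<subseteq> \<rho>" using \<rho>(2) L(2) by blast
    then obtain y where y: "y \<in> \<rho>" "(step (insert u \<kappa>))\<^sup>*\<^sup>* z (\<rho>, y)"
      using steps_to_facet[OF uK z(2) \<rho>(1)] by blast
    have "s = cls u (\<rho>, y)" using z(1) cls_eq[OF y(2)] by simp
    then show ?thesis using \<rho> y(1) by (intro exI[of _ "(\<rho>, y)"]) (auto simp: flags_def)
  qed
  have cls_in: "cls v z \<in> P v" if "z \<in> flags d K \<kappa>" "v \<in> fst z" for v z
    using that flags_iff unfolding P_def by blast
  interpret T: vertex_transport ?L P tr
  proof
    show "abstract_complex ?L" by (rule Lc)
  next
    fix u v s assume a: "{u, v} \<in> ?L" "s \<in> P u"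
    then obtain z where "s = cls u z" "z \<in> flags d K \<kappa>" "{u, v} \<subseteq> fst z" using rep by blast
    then show "tr u v s \<in> P v" using tr_cls[OF a(1)] cls_in by simp
  next
    fix v s assume a: "{v} \<in> ?L" "s \<in> P v"
    then obtain z where "s = cls v z" "z \<in> flags d K \<kappa>" "{v} \<subseteq> fst z" using rep by blast
    then show "tr v v s = s" using tr_cls[of v v] a(1) by simp
  next
    fix u v w s assume a: "{u, v, w} \<in> ?L" "s \<in> P u"
    then obtain z where z: "s = cls u z" "z \<in> flags d K \<kappa>" "{u, v, w} \<subseteq> fst z" using rep by blast
    have "{u, v} \<in> ?L" "{v, w} \<in> ?L" "{u, w} \<in> ?L" by (rule sub[OF a(1)]; auto)+
    then show "tr v w (tr u v s) = tr u w s" using tr_cls z by simp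
  qed
  show ?thesis
    unfolding trivial_holonomy_def
  proof (intro allI impI)
    fix \<sigma> x y assume "(step \<kappa>)\<^sup>*\<^sup>* (\<sigma>, x) (\<sigma>, y)"
    then obtain n where "(step \<kappa> ^^ n) (\<sigma>, x) (\<sigma>, y)" using rtranclp_imp_relpowp by metis
    then obtain f where f: "f 0 = (\<sigma>, x)" "f n = (\<sigma>, y)" "\<And>i. i < n \<Longrightarrow> step \<kappa> (f i) (f (Suc i))"
      unfolding relpowp_fun_conv by blast
    show "x = y"
    proof (cases "n = 0")
      case True
      then show ?thesis using f by simp
    next
      case False
      have "\<exists>v. v \<in> fst (f i) \<inter> fst (f (Suc i)) - \<kappa>" if "i < n" for i
      proof -
        have n: "neighbors d K (fst (f i)) (fst (f (Suc i)))" "\<kappa> \<subseteq> fst (f i) \<inter> fst (f (Suc i))"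
          using f(3)[OF that] by (auto simp: perspectivity_step_def split: prod.splits)
        obtain \<rho> where r: "\<rho> = fst (f i) \<inter> fst (f (Suc i))" "card \<rho> = d"
          using n(1) by (rule neighborsE) 
        have "\<rho> \<noteq> \<kappa>" using r(2) \<kappa>(2) by (auto simp: codim_def)
        then show ?thesis using n(2) r(1) by blast
      qed
      then obtain w where w: "\<And>i. i < n \<Longrightarrow> w i \<in> fst (f i) \<inter> fst (f (Suc i)) - \<kappa>" by metis
      \<comment> \<open>the path ends in its first facet, so the walk may be closed up with \<open>w 0\<close>\<close>
      define v where "v = (\<lambda>i. if i < n then w i else w 0)"
      have fl: "f i \<in> flags d K \<kappa>" if "i \<le> n" for i
      proof (cases i)
        case 0
        then show ?thesis using step_flags(1)[OF f(3)[of 0]] False by simp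
      next
        case (Suc j)
        then show ?thesis using step_flags(2)[OF f(3)[of j]] that by simp
      qed
      have v: "v i \<in> fst (f i)" "v i \<notin> \<kappa>" if "i \<le> n" for i
        using that w[of i] w[of 0] f(1,2) False by (auto simp: v_def not_less)
      have vS: "v i \<in> fst (f (Suc i))" if "i < n" for i
        using that w[of i] by (auto simp: v_def)
      have edge: "A \<in> ?L" if "i \<le> n" "A \<subseteq> fst (f i)" "A \<inter> \<kappa> = {}" "A \<noteq> {}" for i A
      proof -
        have F: "fst (f i) \<in> K" "\<kappa> \<subseteq> fst (f i)" using fl[OF that(1)] facet_in by (auto simp: flags_def)
        have "A \<in> K" by (rule face_subset[OF complex F(1) that(2,4)])
        moreover have "A \<union> \<kappa> \<in> K" by (rule face_subset[OF complex F(1)]) (use that F in auto)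
        ultimately show ?thesis using that(3) by (simp add: link_def)
      qed
      have vv: "{v i, v (Suc i)} \<in> ?L" if "i < n" for i
        by (rule edge[of "Suc i"]) (use that v[of i] v[of "Suc i"] vS in auto)
      have lift: "T.lift v (cls (v 0) (f 0)) i = cls (v i) (f i)" if "i \<le> n" for i
        using that
      proof (induction i)
        case (Suc i)
        then have i: "i < n" by simp
        have "step (insert (v i) \<kappa>) (f i) (f (Suc i))"
          using f(3)[OF i] v(1)[of i] vS[OF i] i by (auto simp: perspectivity_step_def split: prod.splits)
        then have "cls (v i) (f i) = cls (v i) (f (Suc i))" by (intro cls_eq) blast
        then show ?case using Suc tr_cls[OF vv[OF i] fl[of "Suc i"] vS[OF i] v(1)[of "Suc i"]] i by simp
      qed simp
      have v0: "v n = v 0" using False by (simp add: v_def)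
      have "T.lift v (cls (v 0) (f 0)) n = cls (v 0) (f 0)"
        by (rule T.trivial_monodromy[OF sc vv v0 cls_in]) (use fl v in auto)
      then have "cls (v 0) (f 0) = cls (v 0) (f n)" using lift[of n] v0 by simp
      then have "(step (insert (v 0) \<kappa>))\<^sup>*\<^sup>* (f 0) (f n)" unfolding cls_def by blast
      moreover have "{v 0} \<in> ?L" by (rule edge[of 0]) (use v[of 0] in auto)
      ultimately show ?thesis using triv f(1,2) unfolding trivial_holonomy_def by metis
    qed
  qed
qed

theorem trivial_holonomy_off_odd:
  assumes "\<kappa> \<in> K" "\<kappa> \<notin> odd_subcomplex d K"
  shows "trivial_holonomy d K \<kappa>"
  using assms
proof (induction "codim d \<kappa>" arbitrary: \<kappa> rule: less_induct)
  case less
  note \<kappa> = less.prems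
  consider "codim d \<kappa> \<le> 1" | "codim d \<kappa> = 2" | "codim d \<kappa> > 2" by linarith
  then show ?case
  proof cases
    case 1
    then show ?thesis using trivial_holonomy_codim_le_1 \<kappa> by blast
  next
    case 2
    then have "bipartite_graph (link K \<kappa>)"
      using \<kappa> by (auto simp: odd_subcomplex_def odd_faces_def)
    then show ?thesis using trivial_holonomy_bipartite \<kappa> 2 by blast
  next
    case 3
    then have sc: "simply_connected (polyhedron_of (link K \<kappa>))"
      using nice \<kappa> by (simp add: nice_complex_def locally_strongly_simply_connected_def)
    have "trivial_holonomy d K (insert v \<kappa>)" if "{v} \<in> link K \<kappa>" for v
    proof (rule less.hyps)
      have v: "v \<notin> \<kappa>" "insert v \<kappa> \<in> K" using that by (auto simp: link_def)
      then show "insert v \<kappa> \<in> K" by simp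
      show "codim d (insert v \<kappa>) < codim d \<kappa>"
        using 3 v face_finite[OF complex \<kappa>(1)] by (simp add: codim_def)
      show "insert v \<kappa> \<notin> odd_subcomplex d K"
        using \<kappa> by (auto simp: odd_subcomplex_def)
    qed
    then show ?thesis using trivial_holonomy_simply_connected \<kappa>(1) 3 sc by blast
  qed
qed

end

section \<open>Connectedness of simplices without part of their boundary\<close>

definition barycenter :: "'v set \<Rightarrow> 'v \<Rightarrow> real" where
  "barycenter \<sigma> v = (if v \<in> \<sigma> then 1 / card \<sigma> else 0)"

lemma barycenter:
  assumes "finite \<sigma>" "\<sigma> \<noteq> {}"
  shows "barycenter \<sigma> \<in> geo_simplex \<sigma>" "carrier (barycenter \<sigma>) = \<sigma>"
proof -
  have c: "0 < card \<sigma>" using assms by (simp add: card_gt_0_iff)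
  show "barycenter \<sigma> \<in> geo_simplex \<sigma>"
    using c by (simp add: geo_simplex_def barycenter_def)
  show "carrier (barycenter \<sigma>) = \<sigma>"
    using c by (auto simp: carrier_def barycenter_def)
qed

text \<open>The set is star-shaped: on a segment to the barycenter, every point but possibly the first is in the relative
  interior, hence in \<open>S\<close>.\<close>

lemma connected_simplex_Int:
  assumes f: "finite \<sigma>" "\<sigma> \<noteq> {}"
    and S: "\<And>x. x \<in> geo_simplex \<sigma> \<Longrightarrow> carrier x = \<sigma> \<Longrightarrow> x \<in> S"
  shows "connected (geo_simplex \<sigma> \<inter> S)"
proof -
  let ?b = "barycenter \<sigma>"
  define seg where "seg = (\<lambda>x t v. (1 - t) * x v + t * ?b v)"
  note b = barycenter[OF f]
  have in_seg: "seg x t \<in> geo_simplex \<sigma> \<inter> S" if x: "x \<in> geo_simplex \<sigma> \<inter> S" and t: "t \<in> {0..1}" for x t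
  proof (cases "t = 0")
    case True
    then show ?thesis using x by (simp add: seg_def)
  next
    case False
    have xg: "0 \<le> x v" "v \<notin> \<sigma> \<Longrightarrow> x v = 0" "sum x \<sigma> = 1" for v
      using x by (simp_all add: geo_simplex_def)
    have bg: "0 \<le> ?b v" "v \<notin> \<sigma> \<Longrightarrow> ?b v = 0" "sum ?b \<sigma> = 1" "v \<in> \<sigma> \<Longrightarrow> 0 < ?b v" for v
      using b f by (simp_all add: geo_simplex_def barycenter_def card_gt_0_iff)
    have sum: "sum (seg x t) \<sigma> = 1"
      unfolding seg_def sum.distrib sum_distrib_left[symmetric] xg(3) bg(3) by simp
    have pos: "0 < seg x t v" if "v \<in> \<sigma>" for v
      unfolding seg_def using xg(1)[of v] bg(4)[OF that] t False by (intro add_nonneg_pos) auto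
    have zero: "seg x t v = 0" if "v \<notin> \<sigma>" for v
      unfolding seg_def using xg(2)[OF that] bg(2)[OF that] by simp
    have "seg x t \<in> geo_simplex \<sigma>"
      unfolding geo_simplex_def using sum pos zero by (smt (verit, best) mem_Collect_eq)
    moreover have "carrier (seg x t) = \<sigma>"
      unfolding carrier_def using pos zero by (smt (verit, best) Collect_cong Collect_mem_eq)
    ultimately show ?thesis using S by blast
  qed
  have "geo_simplex \<sigma> \<inter> S = (\<Union>x \<in> geo_simplex \<sigma> \<inter> S. seg x ` {0..1})" (is "?A = ?B")
  proof
    have "seg x 0 = x" for x by (simp add: seg_def)
    then show "?A \<subseteq> ?B" by (force intro: image_eqI[of _ _ 0])
    show "?B \<subseteq> ?A" using in_seg by blast
  qed
  moreover have "connected ?B"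
  proof (rule connected_Union)
    fix s assume "s \<in> (\<lambda>x. seg x ` {0..1}) ` (geo_simplex \<sigma> \<inter> S)"
    then obtain x where "s = seg x ` {0..1}" by blast
    moreover have "continuous_on {0..1} (seg x)"
      unfolding seg_def
      by (intro continuous_on_coordinatewise_then_product continuous_intros)
    ultimately show "connected s" by (simp add: connected_continuous_image)
  next
    have "seg x 1 = ?b" for x by (simp add: seg_def)
    then have "?b \<in> \<Inter>((\<lambda>x. seg x ` {0..1}) ` (geo_simplex \<sigma> \<inter> S))"
      by (auto intro!: image_eqI[of _ _ 1] simp: eq_commute)
    then show "\<Inter>((\<lambda>x. seg x ` {0..1}) ` (geo_simplex \<sigma> \<inter> S)) \<noteq> {}" by blast
  qed
  ultimately show ?thesis by simp
qed

section \<open>Spaces glued from copies of facets\<close>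

definition glued :: "nat \<Rightarrow> 'v set set \<Rightarrow> ('v set \<times> 'l) set \<Rightarrow>
    ('v set \<times> 'l \<Rightarrow> 'v set \<times> 'l \<Rightarrow> bool) \<Rightarrow> 'v set \<Rightarrow> 'v set \<times> 'l \<Rightarrow> 'v set \<times> 'l \<Rightarrow> bool" where
  "glued d K I G \<kappa> i j \<longleftrightarrow>
     i \<in> I \<and> j \<in> I \<and> neighbors d K (fst i) (fst j) \<and> G i j \<and> \<kappa> \<subseteq> fst i \<inter> fst j"

context nice_simplicial_complex
begin

lemma facets_connected:
  assumes "\<sigma> \<in> facets d K" "\<tau> \<in> facets d K"
  shows "(neighbors_around d K {})\<^sup>*\<^sup>* \<sigma> \<tau>"
proof -
  obtain \<gamma> where \<gamma>: "facet_path d K \<gamma>" "hd \<gamma> = \<sigma>" "last \<gamma> = \<tau>"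
    using strong assms unfolding strongly_connected_def by blast
  have "neighbors_around d K {} = neighbors d K"
    by (simp add: neighbors_around_def fun_eq_iff)
  then show ?thesis
    using successively_imp_rtranclp[of "neighbors d K" \<gamma>] \<gamma> by (simp add: facet_path_def)
qed

text \<open>Membership in a subcomplex depends on the carrier only.\<close>

lemma odd_complement_iff:
  "x \<in> odd_complement d K \<longleftrightarrow> x \<in> polyhedron_of K \<and> carrier x \<notin> odd_subcomplex d K"
proof -
  have "x \<in> polyhedron_of (odd_subcomplex d K) \<longleftrightarrow> carrier x \<in> odd_subcomplex d K"
    if x: "x \<in> polyhedron_of K"
  proof
    assume "x \<in> polyhedron_of (odd_subcomplex d K)"
    then obtain \<tau> where t: "\<tau> \<in> odd_subcomplex d K" "x \<in> geo_simplex \<tau>"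
      unfolding polyhedron_of_def by blast
    then obtain \<kappa> where "\<kappa> \<in> odd_faces d K" "\<tau> \<subseteq> \<kappa>" unfolding odd_subcomplex_def by blast
    then show "carrier x \<in> odd_subcomplex d K"
      using geo_simplex_carrier(1)[OF t(2)] polyhedron_carrier(1)[OF complex x]
      unfolding odd_subcomplex_def by blast
  next
    assume "carrier x \<in> odd_subcomplex d K"
    then show "x \<in> polyhedron_of (odd_subcomplex d K)"
      using polyhedron_carrier(2)[OF complex x] unfolding polyhedron_of_def by blast
  qed
  then show ?thesis unfolding odd_complement_def by (cases "x \<in> polyhedron_of K") simp_all
qed

definition open_star :: "'v set \<Rightarrow> ('v \<Rightarrow> real) set" where
  "open_star \<kappa> = {x \<in> polyhedron_of K. \<kappa> \<subseteq> carrier x}"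

lemma open_star_odd_complement:
  assumes "\<kappa> \<in> K" "\<kappa> \<notin> odd_subcomplex d K"
  shows "open_star \<kappa> \<subseteq> odd_complement d K"
proof
  fix x assume "x \<in> open_star \<kappa>"
  then have x: "x \<in> polyhedron_of K" "\<kappa> \<subseteq> carrier x" by (simp_all add: open_star_def)
  have "carrier x \<notin> odd_subcomplex d K"
    using assms x(2) unfolding odd_subcomplex_def by blast
  then show "x \<in> odd_complement d K" using x(1) by (simp add: odd_complement_iff)
qed

lemma open_carrier_superset:
  assumes "finite \<kappa>"
  shows "open {x :: 'v \<Rightarrow> real. \<kappa> \<subseteq> carrier x}"
proof -
  have "{x :: 'v \<Rightarrow> real. \<kappa> \<subseteq> carrier x} = (\<Inter>v\<in>\<kappa>. {x. x v \<noteq> 0})"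
    by (auto simp: carrier_def)
  moreover have "open {x :: 'v \<Rightarrow> real. x v \<noteq> 0}" for v
    by (intro open_Collect_neq continuous_on_const) simp
  then have "open (\<Inter>v\<in>\<kappa>. {x :: 'v \<Rightarrow> real. x v \<noteq> 0})"
    using assms by (intro open_INT) blast+
  ultimately show ?thesis by simp
qed

text \<open>The odd subcomplex has dimension at most \<open>d - 2\<close>, so it misses the relative interiors of
  facets and ridges.\<close>

lemma interior_point_odd_complement:
  assumes "\<sigma> \<in> K" "d \<le> card \<sigma>" "x \<in> geo_simplex \<sigma>" "carrier x = \<sigma>"
  shows "x \<in> odd_complement d K"
proof -
  have "x \<in> polyhedron_of K" using assms unfolding polyhedron_of_def by blast
  moreover have "\<sigma> \<notin> odd_subcomplex d K"
  proof
    assume "\<sigma> \<in> odd_subcomplex d K"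
    then obtain \<kappa> where k: "\<kappa> \<in> K" "codim d \<kappa> = 2" "\<sigma> \<subseteq> \<kappa>"
      by (auto simp: odd_subcomplex_def odd_faces_def)
    then have "card \<sigma> \<le> card \<kappa>" using face_finite[OF complex] by (intro card_mono) auto
    then show False using k(2) assms(2) by (simp add: codim_def)
  qed
  ultimately show ?thesis using assms(4) by (simp add: odd_complement_iff)
qed

end

text \<open>What the two unfoldings have in common: an index is a facet with a label, each index extends
  to every neighboring facet, and moving around a face outside of the odd subcomplex never leads
  to a second label of the same facet.\<close>

locale nice_unfolding = nice_simplicial_complex d K
  for d :: nat and K :: "'v set set" +
  fixes I :: "('v set \<times> 'l) set" and G :: "'v set \<times> 'l \<Rightarrow> 'v set \<times> 'l \<Rightarrow> bool"
  assumes index_facet: "i \<in> I \<Longrightarrow> fst i \<in> facets d K"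
    and G_sym: "i \<in> I \<Longrightarrow> j \<in> I \<Longrightarrow> neighbors d K (fst i) (fst j) \<Longrightarrow> G i j \<Longrightarrow> G j i"
    and G_extend: "i \<in> I \<Longrightarrow> neighbors d K (fst i) \<tau> \<Longrightarrow> \<exists>l. (\<tau>, l) \<in> I \<and> G i (\<tau>, l)"
    and G_holonomy: "\<kappa> \<in> K \<Longrightarrow> \<kappa> \<notin> odd_subcomplex d K \<Longrightarrow>
      (glued d K I G \<kappa>)\<^sup>*\<^sup>* i j \<Longrightarrow> fst i = fst j \<Longrightarrow> i = j"
begin

abbreviation gl where "gl \<equiv> glued d K I G"

definition glue_rel where "glue_rel = generated_equiv (topspace (copies I)) (gluing d K I G)"

definition total where "total = glued_space d K I G"

definition pt where "pt i x = glue_rel `` {(i, x)}"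

lemma gl_sym: "gl \<kappa> i j \<Longrightarrow> gl \<kappa> j i"
  unfolding glued_def using G_sym neighbors_sym by blast

lemma gls_sym: "(gl \<kappa>)\<^sup>*\<^sup>* i j \<Longrightarrow> (gl \<kappa>)\<^sup>*\<^sup>* j i"
  by (induction rule: rtranclp_induct) (auto intro: gl_sym converse_rtranclp_into_rtranclp)

lemma gls_mono:
  assumes "(gl \<kappa>)\<^sup>*\<^sup>* i j" "\<kappa>' \<subseteq> \<kappa>"
  shows "(gl \<kappa>')\<^sup>*\<^sup>* i j"
proof -
  have "gl \<kappa> \<le> gl \<kappa>'"
    using assms(2) unfolding glued_def le_fun_def le_bool_def by blast
  then show ?thesis using rtranclp_mono assms(1) by blast
qed

lemma gls_in: "(gl \<kappa>)\<^sup>*\<^sup>* i j \<Longrightarrow> i \<in> I \<Longrightarrow> j \<in> I"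
  by (induction rule: rtranclp_induct) (auto simp: glued_def)

lemma gls_face: "(gl \<kappa>)\<^sup>*\<^sup>* i j \<Longrightarrow> \<kappa> \<subseteq> fst i \<Longrightarrow> \<kappa> \<subseteq> fst j"
  by (induction rule: rtranclp_induct) (auto simp: glued_def)

lemma gls_along_facets:
  assumes "(neighbors_around d K \<kappa>)\<^sup>*\<^sup>* (fst i) \<tau>" "i \<in> I"
  shows "\<exists>j. fst j = \<tau> \<and> (gl \<kappa>)\<^sup>*\<^sup>* i j"
  using assms
proof (induction rule: rtranclp_induct)
  case (step \<tau> \<upsilon>)
  then obtain j where j: "fst j = \<tau>" "(gl \<kappa>)\<^sup>*\<^sup>* i j" by blast
  then have "j \<in> I" using gls_in step.prems by blast
  moreover have n: "neighbors d K (fst j) \<upsilon>" "\<kappa> \<subseteq> \<tau> \<inter> \<upsilon>"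
    using step.hyps(2) j(1) by (simp_all add: neighbors_around_def)
  ultimately obtain l where "(\<upsilon>, l) \<in> I" "G j (\<upsilon>, l)" using G_extend by blast
  then have "gl \<kappa> j (\<upsilon>, l)" using \<open>j \<in> I\<close> n j(1) by (simp add: glued_def)
  then show ?case using j(2) by (metis fst_conv rtranclp.rtrancl_into_rtrancl)
qed blast

lemma index_finite: "i \<in> I \<Longrightarrow> finite (fst i)"
  using index_facet facet_finite by blast

lemma geo_iff: "i \<in> I \<Longrightarrow> j \<in> I \<Longrightarrow> x \<in> geo_simplex (fst i) \<Longrightarrow> x \<in> geo_simplex (fst j) \<longleftrightarrow> carrier x \<subseteq> fst j"
  using geo_simplex_iff_carrier index_finite by blast

lemma gls_geo:
  assumes "(gl (carrier x))\<^sup>*\<^sup>* i j" "i \<in> I" "x \<in> geo_simplex (fst i)"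
  shows "x \<in> geo_simplex (fst j)"
  using geo_iff[of i j x] gls_in[OF assms(1,2)] gls_face[OF assms(1)] geo_simplex_carrier(1)[OF assms(3)] assms
  by blast

lemma mem_copies: "(i, x) \<in> topspace (copies I) \<longleftrightarrow> i \<in> I \<and> x \<in> geo_simplex (fst i)"
  by (simp add: copies_def)

lemma gluing_iff:
  "((i, x), (j, y)) \<in> gluing d K I G \<longleftrightarrow> y = x \<and> x \<in> geo_simplex (fst i) \<and> gl (carrier x) i j"
proof -
  have "x \<in> geo_simplex (fst i \<inter> fst j) \<longleftrightarrow> x \<in> geo_simplex (fst i) \<and> carrier x \<subseteq> fst i \<inter> fst j"
    if "i \<in> I" "j \<in> I"
  proof
    assume x: "x \<in> geo_simplex (fst i \<inter> fst j)"
    have "finite (fst i)" "finite (fst i \<inter> fst j)" using index_finite[OF that(1)] by auto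
    then show "x \<in> geo_simplex (fst i) \<and> carrier x \<subseteq> fst i \<inter> fst j"
      using geo_simplex_iff_carrier[OF x, of "fst i"] geo_simplex_carrier(1)[OF x] by simp
  next
    assume "x \<in> geo_simplex (fst i) \<and> carrier x \<subseteq> fst i \<inter> fst j"
    moreover have "finite (fst i)" "finite (fst i \<inter> fst j)" using index_finite[OF that(1)] by auto
    ultimately show "x \<in> geo_simplex (fst i \<inter> fst j)"
      using geo_simplex_iff_carrier[of x "fst i" "fst i \<inter> fst j"] by simp
  qed
  then show ?thesis unfolding gluing_def glued_def by blast
qed

lemma gluing_subset: "gluing d K I G \<subseteq> topspace (copies I) \<times> topspace (copies I)"
proof (rule subrelI)
  fix p q assume a: "(p, q) \<in> gluing d K I G"
  obtain i x j y where pq: "p = (i, x)" "q = (j, y)" by (metis surj_pair)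
  have g: "y = x" "x \<in> geo_simplex (fst i)" "gl (carrier x) i j"
    using a gluing_iff pq by simp_all
  then have "i \<in> I" "j \<in> I" by (simp_all add: glued_def)
  moreover have "x \<in> geo_simplex (fst j)" using gls_geo[of x i j] g \<open>i \<in> I\<close> by blast
  ultimately show "(p, q) \<in> topspace (copies I) \<times> topspace (copies I)"
    using g pq mem_copies by simp
qed

lemma equiv_glue_rel: "equiv (topspace (copies I)) glue_rel"
  unfolding glue_rel_def by (rule equiv_generated_equiv[OF gluing_subset])

text \<open>Two points of the copies are identified iff they have the same coordinates and
  their copies are linked by gluings along ridges that all contain the carrier of the point:
  a gluing applies to a point only if the ridge does.\<close>

lemma glue_rel_iff:
  "((i, x), (j, y)) \<in> glue_rel \<longleftrightarrow> i \<in> I \<and> x \<in> geo_simplex (fst i) \<and> y = x \<and> (gl (carrier x))\<^sup>*\<^sup>* i j"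
proof
  let ?A = "topspace (copies I)"
  let ?F = "{(p, q). p \<in> ?A \<and> snd q = snd p \<and> (gl (carrier (snd p)))\<^sup>*\<^sup>* (fst p) (fst q)}"
  have memF: "q \<in> ?A" if "(p, q) \<in> ?F" for p q
  proof -
    obtain i x j y where pq: "p = (i, x)" "q = (j, y)" by (metis surj_pair)
    then have *: "i \<in> I" "x \<in> geo_simplex (fst i)" "y = x" "(gl (carrier x))\<^sup>*\<^sup>* i j"
      using that mem_copies by simp_all
    then show ?thesis using gls_in[OF *(4,1)] gls_geo[OF *(4,1,2)] pq mem_copies by simp
  qed
  have "equiv ?A ?F"
  proof (rule equivI)
    show "?F \<subseteq> ?A \<times> ?A" using memF by blast
    show "refl_on ?A ?F" by (simp add: refl_on_def)
    show "sym ?F"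
    proof (rule symI)
      fix p q assume pq: "(p, q) \<in> ?F"
      then show "(q, p) \<in> ?F" using memF[OF pq] gls_sym by simp
    qed
    show "trans ?F" by (rule transI) (auto intro: rtranclp_trans)
  qed
  moreover have "gluing d K I G \<subseteq> ?F"
  proof (rule subrelI)
    fix p q assume a: "(p, q) \<in> gluing d K I G"
    then have "p \<in> ?A" using gluing_subset by blast
    moreover obtain i x j y where pq: "p = (i, x)" "q = (j, y)" by (metis surj_pair)
    ultimately show "(p, q) \<in> ?F" using a gluing_iff pq by auto
  qed
  ultimately have "glue_rel \<subseteq> ?F" unfolding glue_rel_def generated_equiv_def by blast
  moreover assume "((i, x), (j, y)) \<in> glue_rel"
  ultimately have "((i, x), (j, y)) \<in> ?F" by blast
  then show "i \<in> I \<and> x \<in> geo_simplex (fst i) \<and> y = x \<and> (gl (carrier x))\<^sup>*\<^sup>* i j"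
    using mem_copies by simp
next
  assume a: "i \<in> I \<and> x \<in> geo_simplex (fst i) \<and> y = x \<and> (gl (carrier x))\<^sup>*\<^sup>* i j"
  then have "(gl (carrier x))\<^sup>*\<^sup>* i j" by blast
  then have "((i, x), (j, x)) \<in> glue_rel"
  proof (induction rule: rtranclp_induct)
    case base
    show ?case using equiv_glue_rel a mem_copies by (auto simp: equiv_def refl_on_def)
  next
    case (step j k)
    have "x \<in> geo_simplex (fst j)" using gls_geo[OF step.hyps(1)] a by blast
    then have "((j, x), (k, x)) \<in> gluing d K I G" using step.hyps(2) gluing_iff by blast
    then have "((j, x), (k, x)) \<in> glue_rel" unfolding glue_rel_def generated_equiv_def by blast
    then show ?case using step.IH equiv_glue_rel unfolding equiv_def by (meson transE)
  qed
  then show "((i, x), (j, y)) \<in> glue_rel" using a by blast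
qed

lemma pt_eq_iff:
  assumes "i \<in> I" "x \<in> geo_simplex (fst i)" "j \<in> I" "y \<in> geo_simplex (fst j)"
  shows "pt i x = pt j y \<longleftrightarrow> x = y \<and> (gl (carrier x))\<^sup>*\<^sup>* i j"
proof -
  have "pt i x = pt j y \<longleftrightarrow> ((i, x), (j, y)) \<in> glue_rel"
    unfolding pt_def using assms mem_copies by (intro eq_equiv_class_iff[OF equiv_glue_rel]) simp_all
  then show ?thesis using glue_rel_iff assms by auto
qed

lemma topspace_total: "topspace total = {pt i x | i x. i \<in> I \<and> x \<in> geo_simplex (fst i)}"
proof -
  have "topspace total = topspace (copies I) // glue_rel" by (simp add: total_def glued_space_def glue_rel_def)
  then show ?thesis unfolding quotient_def pt_def using mem_copies by fastforce
qed

lemma pt_in: "i \<in> I \<Longrightarrow> x \<in> geo_simplex (fst i) \<Longrightarrow> pt i x \<in> topspace total"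
  unfolding topspace_total by blast

lemma unfolding_map_pt [simp]: "i \<in> I \<Longrightarrow> x \<in> geo_simplex (fst i) \<Longrightarrow> unfolding_map (pt i x) = x"
  unfolding pt_def glue_rel_def by (rule unfolding_map_class)

lemma openin_total:
  "openin total U \<longleftrightarrow> U \<subseteq> topspace total \<and>
     (\<forall>i\<in>I. openin (top_of_set (geo_simplex (fst i))) {x \<in> geo_simplex (fst i). pt i x \<in> U})"
proof -
  have *: "openin (copies I) {p \<in> topspace (copies I). glue_rel `` {p} \<in> U} \<longleftrightarrow>
      (\<forall>i\<in>I. openin (top_of_set (geo_simplex (fst i))) {x \<in> geo_simplex (fst i). pt i x \<in> U})"
  proof -
    have "{x. (i, x) \<in> {p \<in> topspace (copies I). glue_rel `` {p} \<in> U}} = {x \<in> geo_simplex (fst i). pt i x \<in> U}"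
      if "i \<in> I" for i
      using that mem_copies by (simp add: pt_def)
    moreover have "{p \<in> topspace (copies I). glue_rel `` {p} \<in> U} \<subseteq> topspace (copies I)" by blast
    ultimately show ?thesis by (simp add: copies_def openin_sum_topology)
  qed
  have "openin total U \<longleftrightarrow> U \<subseteq> topspace total \<and> openin (copies I) {p \<in> topspace (copies I). glue_rel `` {p} \<in> U}"
    by (simp add: total_def glued_space_def glue_rel_def openin_quotient_space)
  then show ?thesis using * by simp
qed

lemma continuous_unfolding_map: "continuous_map total euclidean unfolding_map"
  unfolding continuous_map_def
proof (intro conjI allI impI)
  fix T :: "('v \<Rightarrow> real) set" assume "openin euclidean T"
  then have T: "open T" by simp
  show "openin total {q \<in> topspace total. unfolding_map q \<in> T}"
    unfolding openin_total
  proof (intro conjI ballI)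
    fix i assume i: "i \<in> I"
    have "{x \<in> geo_simplex (fst i). pt i x \<in> {q \<in> topspace total. unfolding_map q \<in> T}} = geo_simplex (fst i) \<inter> T"
      using pt_in[OF i] i by fastforce
    then show "openin (top_of_set (geo_simplex (fst i)))
        {x \<in> geo_simplex (fst i). pt i x \<in> {q \<in> topspace total. unfolding_map q \<in> T}}"
      using T by (simp add: openin_open_Int)
  qed blast
qed simp

lemma continuous_pt: "i \<in> I \<Longrightarrow> continuous_map (top_of_set (geo_simplex (fst i))) total (pt i)"
  unfolding continuous_map_def using pt_in openin_total by auto

lemma unfolding_map_polyhedron: "q \<in> topspace total \<Longrightarrow> unfolding_map q \<in> polyhedron_of K"
  unfolding topspace_total polyhedron_of_def using index_facet facet_in by fastforce

text \<open>The part over the open star of \<open>\<kappa>\<close> glued from the copies that are linked to \<open>i\<close> around \<open>\<kappa>\<close>.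
  For \<open>\<kappa> = {}\<close> this is the part of the whole space that is glued from the copies linked to \<open>i\<close>;
  it turns out to be a connected component.\<close>

definition sheet :: "'v set \<Rightarrow> 'v set \<times> 'l \<Rightarrow> (('v set \<times> 'l) \<times> ('v \<Rightarrow> real)) set set" where
  "sheet \<kappa> i = {pt j x | j x. (gl \<kappa>)\<^sup>*\<^sup>* i j \<and> x \<in> geo_simplex (fst j) \<and> \<kappa> \<subseteq> carrier x}"

text \<open>Sheets are saturated, as gluings of a point whose carrier contains \<open>\<kappa>\<close> go around \<open>\<kappa>\<close>.\<close>

lemma pt_in_sheet_iff:
  assumes "i \<in> I" "k \<in> I" "x \<in> geo_simplex (fst k)"
  shows "pt k x \<in> sheet \<kappa> i \<longleftrightarrow> (gl \<kappa>)\<^sup>*\<^sup>* i k \<and> \<kappa> \<subseteq> carrier x"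
proof
  assume "pt k x \<in> sheet \<kappa> i"
  then obtain j y where j: "pt k x = pt j y" "(gl \<kappa>)\<^sup>*\<^sup>* i j" "y \<in> geo_simplex (fst j)" "\<kappa> \<subseteq> carrier y"
    unfolding sheet_def by blast
  have "j \<in> I" using gls_in[OF j(2) assms(1)] .
  then have "x = y" "(gl (carrier x))\<^sup>*\<^sup>* k j" using pt_eq_iff[OF assms(2,3) _ j(3)] j(1) by auto
  then have "(gl \<kappa>)\<^sup>*\<^sup>* j k" using gls_sym gls_mono j(4) by blast
  then show "(gl \<kappa>)\<^sup>*\<^sup>* i k \<and> \<kappa> \<subseteq> carrier x"
    using j(2,4) \<open>x = y\<close> by (simp add: rtranclp_trans)
next
  assume "(gl \<kappa>)\<^sup>*\<^sup>* i k \<and> \<kappa> \<subseteq> carrier x"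
  then show "pt k x \<in> sheet \<kappa> i" unfolding sheet_def using assms(3) by blast
qed

lemma sheetE:
  assumes "q \<in> sheet \<kappa> i" "i \<in> I"
  obtains j x where "q = pt j x" "j \<in> I" "x \<in> geo_simplex (fst j)" "(gl \<kappa>)\<^sup>*\<^sup>* i j" "\<kappa> \<subseteq> carrier x"
  using assms gls_in unfolding sheet_def by blast

lemma sheet_subset: "i \<in> I \<Longrightarrow> sheet \<kappa> i \<subseteq> topspace total"
  by (metis sheetE pt_in subsetI)

lemma openin_sheet:
  assumes i: "i \<in> I" and \<kappa>: "finite \<kappa>"
  shows "openin total (sheet \<kappa> i)"
  unfolding openin_total
proof (intro conjI ballI)
  show "sheet \<kappa> i \<subseteq> topspace total" by (rule sheet_subset[OF i])
  fix k assume k: "k \<in> I"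
  show "openin (top_of_set (geo_simplex (fst k))) {x \<in> geo_simplex (fst k). pt k x \<in> sheet \<kappa> i}"
  proof (cases "(gl \<kappa>)\<^sup>*\<^sup>* i k")
    case True
    then have "{x \<in> geo_simplex (fst k). pt k x \<in> sheet \<kappa> i} = geo_simplex (fst k) \<inter> {x. \<kappa> \<subseteq> carrier x}"
      using pt_in_sheet_iff[OF i k] by blast
    then show ?thesis using open_carrier_superset[OF \<kappa>] by (simp add: openin_open_Int)
  next
    case False
    then have "{x \<in> geo_simplex (fst k). pt k x \<in> sheet \<kappa> i} = {}"
      using pt_in_sheet_iff[OF i k] by blast
    then show ?thesis by (simp only: openin_empty)
  qed
qed

lemma sheet_eq:
  assumes "(gl \<kappa>)\<^sup>*\<^sup>* i j"
  shows "sheet \<kappa> i = sheet \<kappa> j"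
proof -
  have "(gl \<kappa>)\<^sup>*\<^sup>* i k \<longleftrightarrow> (gl \<kappa>)\<^sup>*\<^sup>* j k" for k
    using assms gls_sym[OF assms] rtranclp_trans[of "gl \<kappa>"] by blast
  then show ?thesis by (simp add: sheet_def)
qed

lemma sheets_disjoint:
  assumes "i \<in> I" "j \<in> I" "q \<in> sheet \<kappa> i" "q \<in> sheet \<kappa> j"
  shows "sheet \<kappa> i = sheet \<kappa> j"
proof -
  obtain k x where k: "q = pt k x" "k \<in> I" "x \<in> geo_simplex (fst k)" "(gl \<kappa>)\<^sup>*\<^sup>* i k"
    using assms(3,1) by (rule sheetE)
  then have "(gl \<kappa>)\<^sup>*\<^sup>* j k" using pt_in_sheet_iff assms(2,4) by blast
  then show ?thesis using sheet_eq k(4) by metis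
qed

text \<open>Two copies in one sheet that contain the same coordinates \<open>x\<close> can be joined around the carrier
  of \<open>x\<close>: strong connectedness joins the facets, lifting yields an index over the second facet,
  and trivial holonomy around \<open>\<kappa>\<close> identifies this index.\<close>

lemma inj_on_sheet:
  assumes \<kappa>: "\<kappa> \<in> K" "\<kappa> \<notin> odd_subcomplex d K" and i: "i \<in> I"
  shows "inj_on unfolding_map (sheet \<kappa> i)"
proof (rule inj_onI)
  fix q q' assume "q \<in> sheet \<kappa> i" "q' \<in> sheet \<kappa> i" and eq: "unfolding_map q = unfolding_map q'"
  obtain j x where j: "q = pt j x" "j \<in> I" "x \<in> geo_simplex (fst j)" "(gl \<kappa>)\<^sup>*\<^sup>* i j" "\<kappa> \<subseteq> carrier x"
    using \<open>q \<in> sheet \<kappa> i\<close> i by (rule sheetE)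
  obtain k y where k: "q' = pt k y" "k \<in> I" "y \<in> geo_simplex (fst k)" "(gl \<kappa>)\<^sup>*\<^sup>* i k" "\<kappa> \<subseteq> carrier y"
    using \<open>q' \<in> sheet \<kappa> i\<close> i by (rule sheetE)
  have xy: "x = y" using eq j k by simp
  have "x \<in> polyhedron_of K"
    using j(2,3) index_facet facet_in unfolding polyhedron_of_def by blast
  then have cK: "carrier x \<in> K" by (rule polyhedron_carrier(1)[OF complex])
  have "carrier x \<subseteq> fst j" "carrier x \<subseteq> fst k"
    using geo_simplex_carrier(1) j(3) k(3) xy by blast+
  then have "(neighbors_around d K (carrier x))\<^sup>*\<^sup>* (fst j) (fst k)"
    using facets_around_connected[OF cK] index_facet j(2) k(2) by blast
  then obtain m where m: "fst m = fst k" "(gl (carrier x))\<^sup>*\<^sup>* j m"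
    using gls_along_facets j(2) by blast
  have "(gl \<kappa>)\<^sup>*\<^sup>* j m" using gls_mono[OF m(2) j(5)] .
  moreover have "(gl \<kappa>)\<^sup>*\<^sup>* k j" using gls_sym[OF k(4)] j(4) by (rule rtranclp_trans)
  ultimately have "(gl \<kappa>)\<^sup>*\<^sup>* k m" by (metis rtranclp_trans)
  then have "k = m" using G_holonomy[OF \<kappa>] m(1) by metis
  then show "q = q'" using pt_eq_iff[OF j(2,3) k(2,3)] j(1) k(1) m(2) xy by simp
qed

lemma sheet_over_facet:
  assumes "\<kappa> \<in> K" "i \<in> I" "\<kappa> \<subseteq> fst i" "\<sigma> \<in> facets d K" "\<kappa> \<subseteq> \<sigma>"
  obtains j where "j \<in> I" "fst j = \<sigma>" "(gl \<kappa>)\<^sup>*\<^sup>* i j"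
  using gls_along_facets[OF facets_around_connected[OF assms(1) index_facet[OF assms(2)] assms(3-5)] assms(2)]
    gls_in assms(2) that by blast

lemma geo_simplex_mono:
  assumes "\<tau> \<in> K" "\<sigma> \<in> K" "\<tau> \<subseteq> \<sigma>"
  shows "geo_simplex \<tau> \<subseteq> geo_simplex \<sigma>"
proof
  fix x assume x: "x \<in> geo_simplex \<tau>"
  then show "x \<in> geo_simplex \<sigma>"
    using geo_simplex_iff_carrier[OF x face_finite[OF complex assms(1)] face_finite[OF complex assms(2)]]
      geo_simplex_carrier(1)[OF x] assms(3) by blast
qed

lemma image_sheet:
  assumes \<kappa>: "\<kappa> \<in> K" and i: "i \<in> I" "\<kappa> \<subseteq> fst i"
  shows "unfolding_map ` sheet \<kappa> i = open_star \<kappa>"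
proof (intro equalityI subsetI)
  fix x assume "x \<in> unfolding_map ` sheet \<kappa> i"
  then obtain q where q: "q \<in> sheet \<kappa> i" "x = unfolding_map q" by blast
  obtain j y where j: "q = pt j y" "j \<in> I" "y \<in> geo_simplex (fst j)" "\<kappa> \<subseteq> carrier y"
    using q(1) i(1) by (rule sheetE)
  then have "x = y" using q(2) by simp
  moreover have "x \<in> polyhedron_of K"
    using unfolding_map_polyhedron sheet_subset[OF i(1)] q by blast
  ultimately show "x \<in> open_star \<kappa>" using j(4) by (simp add: open_star_def)
next
  fix x assume "x \<in> open_star \<kappa>"
  then have x: "x \<in> polyhedron_of K" "\<kappa> \<subseteq> carrier x" by (simp_all add: open_star_def)
  note c = polyhedron_carrier[OF complex x(1)]
  obtain \<sigma> where \<sigma>: "\<sigma> \<in> facets d K" "carrier x \<subseteq> \<sigma>" using facet_containing[OF c(1)] by blast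
  then obtain j where j: "j \<in> I" "fst j = \<sigma>" "(gl \<kappa>)\<^sup>*\<^sup>* i j"
    using sheet_over_facet[OF \<kappa> i \<sigma>(1)] x(2) by blast
  have "x \<in> geo_simplex (fst j)"
    using geo_simplex_mono[OF c(1) facet_in[OF \<sigma>(1)] \<sigma>(2)] c(2) j(2) by blast
  then have "pt j x \<in> sheet \<kappa> i" "unfolding_map (pt j x) = x"
    using pt_in_sheet_iff i(1) j x(2) by simp_all
  then show "x \<in> unfolding_map ` sheet \<kappa> i" by (metis imageI)
qed

text \<open>Openness may be tested on each simplex \<open>\<tau>\<close> of the complex.  Over a facet through \<open>\<tau>\<close> the
  sheet consists of a single copy, in which the preimage of \<open>W\<close> is open by the definition of the
  quotient topology.\<close>

lemma openin_image_sheet: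
  assumes \<kappa>: "\<kappa> \<in> K" "\<kappa> \<notin> odd_subcomplex d K" and i: "i \<in> I" "\<kappa> \<subseteq> fst i"
    and W: "openin total W" "W \<subseteq> sheet \<kappa> i"
  shows "openin (realization K) (unfolding_map ` W)"
  unfolding realization_weak_topology[OF complex locally_finite]
proof (intro conjI ballI)
  have star: "unfolding_map ` W \<subseteq> open_star \<kappa>" using image_sheet[OF \<kappa>(1) i] W(2) by blast
  then show "unfolding_map ` W \<subseteq> polyhedron_of K" unfolding open_star_def by blast
  fix \<tau> assume \<tau>: "\<tau> \<in> K"
  show "openin (top_of_set (geo_simplex \<tau>)) (unfolding_map ` W \<inter> geo_simplex \<tau>)"
  proof (cases "\<kappa> \<subseteq> \<tau>")
    case False
    then have "unfolding_map ` W \<inter> geo_simplex \<tau> = {}"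
      using star geo_simplex_carrier(1) unfolding open_star_def by blast
    then show ?thesis by simp
  next
    case True
    obtain \<sigma> where \<sigma>: "\<sigma> \<in> facets d K" "\<tau> \<subseteq> \<sigma>" using facet_containing[OF \<tau>] by blast
    then obtain j where j: "j \<in> I" "fst j = \<sigma>" "(gl \<kappa>)\<^sup>*\<^sup>* i j"
      using sheet_over_facet[OF \<kappa>(1) i \<sigma>(1)] True by blast
    have mono: "geo_simplex \<tau> \<subseteq> geo_simplex \<sigma>" by (rule geo_simplex_mono[OF \<tau> facet_in[OF \<sigma>(1)] \<sigma>(2)])
    let ?S = "{x \<in> geo_simplex \<sigma>. pt j x \<in> W}"
    have "openin (top_of_set (geo_simplex \<sigma>)) ?S" using W(1) j(1,2) openin_total by blast
    then obtain T where T: "open T" "?S = geo_simplex \<sigma> \<inter> T" unfolding openin_open by blast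
    have "unfolding_map ` W \<inter> geo_simplex \<tau> = ?S \<inter> geo_simplex \<tau>"
    proof (intro equalityI subsetI)
      fix x assume "x \<in> unfolding_map ` W \<inter> geo_simplex \<tau>"
      then obtain q where q: "q \<in> W" "x = unfolding_map q" "x \<in> geo_simplex \<tau>" by blast
      then have x: "x \<in> geo_simplex (fst j)" "\<kappa> \<subseteq> carrier x"
        using mono j(2) star unfolding open_star_def by blast+
      then have "pt j x \<in> sheet \<kappa> i" using pt_in_sheet_iff[OF i(1) j(1)] j(3) by blast
      moreover have "unfolding_map (pt j x) = unfolding_map q" using x j(1) q(2) by simp
      ultimately have "pt j x = q" using inj_on_sheet[OF \<kappa> i(1)] W(2) q(1) by (meson inj_onD subsetD)
      then show "x \<in> ?S \<inter> geo_simplex \<tau>" using q x(1) j(2) by simp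
    next
      fix x assume "x \<in> ?S \<inter> geo_simplex \<tau>"
      then have x: "x \<in> geo_simplex (fst j)" "pt j x \<in> W" "x \<in> geo_simplex \<tau>" using j(2) by auto
      have "unfolding_map (pt j x) = x" using x(1) j(1) by simp
      then have "x \<in> unfolding_map ` W" using x(2) by (metis imageI)
      then show "x \<in> unfolding_map ` W \<inter> geo_simplex \<tau>" using x(3) by blast
    qed
    also have "\<dots> = geo_simplex \<tau> \<inter> T" using T(2) mono by blast
    finally show ?thesis using T(1) by (simp add: openin_open_Int)
  qed
qed

lemma homeomorphic_sheet:
  assumes \<kappa>: "\<kappa> \<in> K" "\<kappa> \<notin> odd_subcomplex d K" and i: "i \<in> I" "\<kappa> \<subseteq> fst i"
  shows "homeomorphic_map (subtopology total (sheet \<kappa> i)) (subtopology (realization K) (open_star \<kappa>)) unfolding_map"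
proof (rule bijective_open_imp_homeomorphic_map)
  let ?S = "sheet \<kappa> i" and ?T = "open_star \<kappa>"
  have tS: "topspace (subtopology total ?S) = ?S" using sheet_subset[OF i(1)] by (simp add: Int_absorb1)
  have TK: "?T \<subseteq> polyhedron_of K" by (auto simp: open_star_def)
  then have TT: "subtopology (realization K) ?T = top_of_set ?T"
    by (simp add: subtopology_subtopology Int_absorb1)
  note im = image_sheet[OF \<kappa>(1) i]
  show "continuous_map (subtopology total ?S) (subtopology (realization K) ?T) unfolding_map"
    unfolding TT continuous_map_in_subtopology using tS im continuous_unfolding_map
    by (auto intro: continuous_map_from_subtopology)
  show "open_map (subtopology total ?S) (subtopology (realization K) ?T) unfolding_map"
    unfolding open_map_def
  proof (intro allI impI)
    fix W assume "openin (subtopology total ?S) W"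
    then have W: "openin total W" "W \<subseteq> ?S"
      using openin_open_subtopology[OF openin_sheet[OF i(1) face_finite[OF complex \<kappa>(1)]]] by blast+
    then have "openin (realization K) (unfolding_map ` W)" using openin_image_sheet[OF \<kappa> i] by blast
    moreover have "unfolding_map ` W \<subseteq> ?T" using im W(2) by blast
    ultimately show "openin (subtopology (realization K) ?T) (unfolding_map ` W)"
      by (metis inf.absorb1 openin_subtopology_Int)
  qed
  show "unfolding_map ` topspace (subtopology total ?S) = topspace (subtopology (realization K) ?T)"
    unfolding tS TT im by simp
  show "inj_on unfolding_map (topspace (subtopology total ?S))"
    unfolding tS by (rule inj_on_sheet[OF \<kappa> i(1)])
qed

text \<open>A point \<open>y\<close> of the complement is evenly covered by the open star of its carrier \<open>\<kappa>\<close>: the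
  sheets over it are those around \<open>\<kappa>\<close> of the indices linked to \<open>i\<close>.  Surjectivity is
  where strong connectedness of the whole complex enters.\<close>

lemma covering_map_component:
  assumes i: "i \<in> I"
  shows "covering_map (subtopology total (sheet {} i \<inter> unfolding_map -` odd_complement d K))
    (subtopology (realization K) (odd_complement d K)) unfolding_map"
proof -
  let ?O = "odd_complement d K" and ?C = "sheet {} i"
  let ?D = "?C \<inter> unfolding_map -` ?O"
  let ?Y = "subtopology total ?D" and ?Z = "subtopology (realization K) ?O"
  have OK: "?O \<subseteq> polyhedron_of K" by (auto simp: odd_complement_def)
  then have Z: "?Z = top_of_set ?O" by (simp add: subtopology_subtopology Int_absorb1)
  have tY: "topspace ?Y = ?D" using sheet_subset[OF i, of "{}"] by auto
  have tZ: "topspace ?Z = ?O" unfolding Z by simp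
  have cont: "continuous_map ?Y ?Z unfolding_map"
    unfolding Z continuous_map_in_subtopology using tY continuous_unfolding_map
    by (auto intro: continuous_map_from_subtopology)
  have over: "\<exists>j. j \<in> I \<and> x \<in> geo_simplex (fst j) \<and> pt j x \<in> ?C" if "x \<in> polyhedron_of K" for x
  proof -
    note c = polyhedron_carrier[OF complex that]
    obtain \<sigma> where \<sigma>: "\<sigma> \<in> facets d K" "carrier x \<subseteq> \<sigma>" using facet_containing[OF c(1)] by blast
    then obtain j where j: "fst j = \<sigma>" "(gl {})\<^sup>*\<^sup>* i j"
      using gls_along_facets facets_connected[OF index_facet[OF i]] i by blast
    have "x \<in> geo_simplex (fst j)"
      using geo_simplex_mono[OF c(1) facet_in[OF \<sigma>(1)] \<sigma>(2)] c(2) j(1) by blast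
    moreover have "j \<in> I" using gls_in[OF j(2) i] .
    ultimately show ?thesis using pt_in_sheet_iff[OF i] j(2) by blast
  qed
  have onto: "unfolding_map ` topspace ?Y = topspace ?Z"
    unfolding tY tZ
  proof (intro equalityI subsetI)
    fix x assume x: "x \<in> ?O"
    then obtain j where j: "j \<in> I" "x \<in> geo_simplex (fst j)" "pt j x \<in> ?C" using over OK by blast
    then have "unfolding_map (pt j x) = x" by simp
    then show "x \<in> unfolding_map ` ?D" using j(3) x by (metis IntI imageI vimageI)
  qed blast
  have even: "\<exists>T. y \<in> T \<and> openin ?Z T \<and> (\<exists>\<V>. \<Union>\<V> = {x \<in> topspace ?Y. unfolding_map x \<in> T} \<and>
      (\<forall>U\<in>\<V>. openin ?Y U) \<and> pairwise disjnt \<V> \<and>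
      (\<forall>U\<in>\<V>. homeomorphic_map (subtopology ?Y U) (subtopology ?Z T) unfolding_map))"
    if y: "y \<in> ?O" for y
  proof -
    define \<kappa> where "\<kappa> = carrier y"
    have yK: "y \<in> polyhedron_of K" using y OK by blast
    have \<kappa>: "\<kappa> \<in> K" "\<kappa> \<notin> odd_subcomplex d K"
      using polyhedron_carrier(1)[OF complex yK] y odd_complement_iff unfolding \<kappa>_def by blast+
    let ?T = "open_star \<kappa>"
    have TO: "?T \<subseteq> ?O" by (rule open_star_odd_complement[OF \<kappa>])
    define \<V> where "\<V> = {sheet \<kappa> j | j. (gl {})\<^sup>*\<^sup>* i j \<and> \<kappa> \<subseteq> fst j}"
    have sheetD: "sheet \<kappa> j \<subseteq> ?D" if j: "(gl {})\<^sup>*\<^sup>* i j" "\<kappa> \<subseteq> fst j" for j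
    proof
      fix q assume q: "q \<in> sheet \<kappa> j"
      have jI: "j \<in> I" using gls_in[OF j(1) i] .
      obtain k x where k: "q = pt k x" "k \<in> I" "x \<in> geo_simplex (fst k)" "(gl \<kappa>)\<^sup>*\<^sup>* j k" "\<kappa> \<subseteq> carrier x"
        using q jI by (rule sheetE)
      have "(gl {})\<^sup>*\<^sup>* j k" by (rule gls_mono[OF k(4)]) simp
      then have "(gl {})\<^sup>*\<^sup>* i k" using j(1) by (rule rtranclp_trans[rotated])
      then have "q \<in> ?C" using pt_in_sheet_iff[OF i k(2,3)] k(1) by simp
      moreover have "unfolding_map q \<in> ?T" using image_sheet[OF \<kappa>(1) jI j(2)] q by blast
      ultimately show "q \<in> ?D" using TO by blast
    qed
    have openT: "openin ?Z ?T"
    proof -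
      have "?T = ?O \<inter> {x. \<kappa> \<subseteq> carrier x}" using TO OK unfolding open_star_def by blast
      then show ?thesis
        unfolding Z using open_carrier_superset[OF face_finite[OF complex \<kappa>(1)]] by (simp add: openin_open_Int)
    qed
    have union: "\<Union>\<V> = {q \<in> topspace ?Y. unfolding_map q \<in> ?T}"
    proof (intro equalityI subsetI)
      fix q assume "q \<in> \<Union>\<V>"
      then obtain j where j: "(gl {})\<^sup>*\<^sup>* i j" "\<kappa> \<subseteq> fst j" "q \<in> sheet \<kappa> j" unfolding \<V>_def by blast
      then show "q \<in> {q \<in> topspace ?Y. unfolding_map q \<in> ?T}"
        unfolding tY using sheetD[OF j(1,2)] image_sheet[OF \<kappa>(1) gls_in[OF j(1) i] j(2)] by blast
    next
      fix q assume "q \<in> {q \<in> topspace ?Y. unfolding_map q \<in> ?T}"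
      then have q: "q \<in> ?C" "unfolding_map q \<in> ?T" unfolding tY by blast+
      obtain j x where j: "q = pt j x" "j \<in> I" "x \<in> geo_simplex (fst j)" "(gl {})\<^sup>*\<^sup>* i j"
        using q(1) i by (rule sheetE)
      then have \<kappa>x: "\<kappa> \<subseteq> carrier x" using q(2) by (simp add: open_star_def)
      then have "q \<in> sheet \<kappa> j" using pt_in_sheet_iff[OF j(2,2,3)] j(1) by blast
      moreover have "\<kappa> \<subseteq> fst j" using geo_simplex_carrier(1)[OF j(3)] \<kappa>x by blast
      ultimately show "q \<in> \<Union>\<V>" using j(4) unfolding \<V>_def by blast
    qed
    have homeo: "openin ?Y U \<and> homeomorphic_map (subtopology ?Y U) (subtopology ?Z ?T) unfolding_map"
      if UV: "U \<in> \<V>" for U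
    proof -
      obtain j where j: "U = sheet \<kappa> j" "(gl {})\<^sup>*\<^sup>* i j" "\<kappa> \<subseteq> fst j" using UV unfolding \<V>_def by blast
      have jI: "j \<in> I" using gls_in[OF j(2) i] .
      have U: "U \<subseteq> ?D" using sheetD j by blast
      have "openin total U" using openin_sheet[OF jI face_finite[OF complex \<kappa>(1)]] j(1) by simp
      then have "openin ?Y U" using U by (metis inf.absorb1 openin_subtopology_Int)
      moreover have "subtopology ?Y U = subtopology total U" "subtopology ?Z ?T = subtopology (realization K) ?T"
        using subtopology_subtopology inf.absorb2[OF U] inf.absorb2[OF TO] by metis+
      ultimately show ?thesis using homeomorphic_sheet[OF \<kappa> jI j(3)] j(1) by simp
    qed
    have disj: "pairwise disjnt \<V>"
    proof (rule pairwiseI)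
      fix U U' assume "U \<in> \<V>" "U' \<in> \<V>" "U \<noteq> U'"
      then obtain j j' where "U = sheet \<kappa> j" "U' = sheet \<kappa> j'" "j \<in> I" "j' \<in> I"
        unfolding \<V>_def using gls_in i by blast
      then show "disjnt U U'" using sheets_disjoint \<open>U \<noteq> U'\<close> unfolding disjnt_def by blast
    qed
    show ?thesis
    proof (intro exI conjI ballI)
      show "y \<in> ?T" using yK by (simp add: open_star_def \<kappa>_def)
      show "openin ?Z ?T" by (rule openT)
      show "\<Union>\<V> = {q \<in> topspace ?Y. unfolding_map q \<in> ?T}" by (rule union)
      show "pairwise disjnt \<V>" by (rule disj)
      fix U assume "U \<in> \<V>"
      then show "openin ?Y U" "homeomorphic_map (subtopology ?Y U) (subtopology ?Z ?T) unfolding_map"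
        using homeo by blast+
    qed
  qed
  show ?thesis
    unfolding covering_map_def
  proof (intro conjI ballI)
    fix y assume "y \<in> topspace ?Z"
    then have "y \<in> ?O" unfolding tZ .
    then show "\<exists>T. y \<in> T \<and> openin ?Z T \<and> (\<exists>\<V>. \<Union>\<V> = {x \<in> topspace ?Y. unfolding_map x \<in> T} \<and>
      (\<forall>U\<in>\<V>. openin ?Y U) \<and> pairwise disjnt \<V> \<and>
      (\<forall>U\<in>\<V>. homeomorphic_map (subtopology ?Y U) (subtopology ?Z T) unfolding_map))"
      by (rule even)
  qed (rule cont, rule onto)
qed

text \<open>With \<open>S = UNIV\<close> this shows that \<open>sheet {} i\<close> is connected, and with the complement of the odd
  subcomplex it gives the connectedness of the covering space.  The barycenters of the crossed
  ridges connect consecutive copies.\<close>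

lemma connected_sheet:
  assumes i: "i \<in> I"
    and S: "\<And>\<sigma> x. \<sigma> \<in> K \<Longrightarrow> d \<le> card \<sigma> \<Longrightarrow> x \<in> geo_simplex \<sigma> \<Longrightarrow> carrier x = \<sigma> \<Longrightarrow> x \<in> S"
  shows "connected_space (subtopology total (sheet {} i \<inter> unfolding_map -` S))"
proof -
  let ?D = "sheet {} i \<inter> unfolding_map -` S"
  let ?Y = "subtopology total ?D"
  have tY: "topspace ?Y = ?D" using sheet_subset[OF i, of "{}"] by auto
  have piece: "connected_component_of ?Y (pt j x) (pt j y)"
    if j: "(gl {})\<^sup>*\<^sup>* i j" and x: "x \<in> geo_simplex (fst j) \<inter> S" and y: "y \<in> geo_simplex (fst j) \<inter> S" for j x y
  proof -
    have jI: "j \<in> I" using gls_in[OF j i] .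
    have F: "fst j \<in> facets d K" using index_facet[OF jI] .
    have "connected (geo_simplex (fst j) \<inter> S)"
    proof (rule connected_simplex_Int)
      show "finite (fst j)" "fst j \<noteq> {}"
        using face_finite[OF complex] face_nonempty[OF complex] facet_in[OF F] by blast+
      show "z \<in> S" if "z \<in> geo_simplex (fst j)" "carrier z = fst j" for z
        using S[OF facet_in[OF F] _ that] F by (simp add: facets_def)
    qed
    then have "connectedin (top_of_set (geo_simplex (fst j))) (geo_simplex (fst j) \<inter> S)"
      by (simp add: connectedin_subtopology)
    then have "connectedin total (pt j ` (geo_simplex (fst j) \<inter> S))"
      using connectedin_continuous_map_image continuous_pt[OF jI] by blast
    moreover have "pt j ` (geo_simplex (fst j) \<inter> S) \<subseteq> ?D"
      using pt_in_sheet_iff[OF i jI] j jI by auto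
    ultimately have "connectedin ?Y (pt j ` (geo_simplex (fst j) \<inter> S))"
      by (simp add: connectedin_subtopology)
    then show ?thesis unfolding connected_component_of_def using x y by blast
  qed
  let ?b = "barycenter (fst i)"
  have b: "?b \<in> geo_simplex (fst i) \<inter> S"
  proof -
    have F: "fst i \<in> facets d K" using index_facet[OF i] .
    note bb = barycenter[OF face_finite[OF complex facet_in[OF F]] face_nonempty[OF complex facet_in[OF F]]]
    then show ?thesis using S[OF facet_in[OF F] _ bb] F by (simp add: facets_def)
  qed
  have reach: "\<forall>x \<in> geo_simplex (fst j) \<inter> S. connected_component_of ?Y (pt i ?b) (pt j x)"
    if "(gl {})\<^sup>*\<^sup>* i j" for j
    using that
  proof (induction rule: rtranclp_induct)
    case base
    then show ?case using piece[OF _ b] by blast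
  next
    case (step j k)
    have g: "j \<in> I" "k \<in> I" "neighbors d K (fst j) (fst k)" "G j k" using step.hyps(2) by (simp_all add: glued_def)
    obtain \<rho> where \<rho>: "\<rho> = fst j \<inter> fst k" "\<rho> \<in> K" "card \<rho> = d" "finite \<rho>"
      using g(3) by (rule neighborsE)
    let ?r = "barycenter \<rho>"
    note r = barycenter[OF \<rho>(4) face_nonempty[OF complex \<rho>(2)]]
    have rS: "?r \<in> S" using S[OF \<rho>(2) _ r] \<rho>(3) by simp
    have jk: "?r \<in> geo_simplex (fst j)" "?r \<in> geo_simplex (fst k)"
      using r geo_simplex_mono[OF \<rho>(2)] \<rho>(1) index_facet g(1,2) facet_in by blast+
    have "gl (carrier ?r) j k" using g r(2) \<rho>(1) by (simp add: glued_def)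
    then have eq: "pt j ?r = pt k ?r" using pt_eq_iff g(1,2) jk by blast
    have ik: "(gl {})\<^sup>*\<^sup>* i k" using step.hyps by (rule rtranclp.rtrancl_into_rtrancl)
    show ?case
    proof
      fix x assume "x \<in> geo_simplex (fst k) \<inter> S"
      then have "connected_component_of ?Y (pt k ?r) (pt k x)" using piece[OF ik] jk(2) rS by blast
      moreover have "connected_component_of ?Y (pt i ?b) (pt k ?r)"
        unfolding eq[symmetric] using step.IH jk(1) rS by blast
      ultimately show "connected_component_of ?Y (pt i ?b) (pt k x)"
        by (rule connected_component_of_trans[rotated])
    qed
  qed
  have all: "connected_component_of ?Y (pt i ?b) q" if "q \<in> ?D" for q
  proof -
    have "q \<in> sheet {} i" using that by blast
    then obtain j x where j: "q = pt j x" "j \<in> I" "x \<in> geo_simplex (fst j)" "(gl {})\<^sup>*\<^sup>* i j"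
      using i by (rule sheetE)
    then have "x \<in> S" using that by simp
    then show ?thesis using reach[OF j(4)] j(1,3) by blast
  qed
  show ?thesis
    unfolding connected_space_iff_connected_component tY
  proof (intro ballI)
    fix q q' assume "q \<in> ?D" "q' \<in> ?D"
    then show "connected_component_of ?Y q q'"
      using all connected_component_of_trans[OF iffD1[OF connected_component_of_sym all]] by blast
  qed
qed

theorem covering_component:
  assumes "i \<in> I"
  shows "covering (subtopology total (sheet {} i \<inter> unfolding_map -` odd_complement d K))
    (subtopology (realization K) (odd_complement d K)) unfolding_map"
  unfolding covering_def
proof
  show "connected_space (subtopology total (sheet {} i \<inter> unfolding_map -` odd_complement d K))"
    by (rule connected_sheet[OF assms]) (rule interior_point_odd_complement)
qed (rule covering_map_component[OF assms])

text \<open>The sets \<open>sheet {} i\<close> are connected, open and partition the space.\<close>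

lemma components_are_sheets:
  assumes "C \<in> connected_components_of total"
  obtains i where "i \<in> I" "C = sheet {} i"
proof -
  obtain q where q: "q \<in> topspace total" "C = connected_component_of_set total q"
    using assms unfolding connected_components_of_def by blast
  then obtain i x where i: "q = pt i x" "i \<in> I" "x \<in> geo_simplex (fst i)" unfolding topspace_total by blast
  let ?S = "sheet {} i"
  have qS: "q \<in> ?S" using pt_in_sheet_iff[OF i(2,2,3)] i(1) by simp
  have "connected_space (subtopology total (?S \<inter> unfolding_map -` UNIV))"
    by (rule connected_sheet[OF i(2)]) simp
  then have "connectedin total ?S" using sheet_subset[OF i(2)] by (simp add: connectedin_def)
  then have "?S \<subseteq> C" using connected_component_of_maximal qS q(2) by metis
  moreover have "C \<subseteq> ?S"
  proof -
    have "topspace total - ?S = \<Union>{sheet {} j | j. j \<in> I \<and> sheet {} j \<noteq> ?S}"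
    proof (intro equalityI subsetI)
      fix p assume p: "p \<in> topspace total - ?S"
      then obtain j y where j: "p = pt j y" "j \<in> I" "y \<in> geo_simplex (fst j)" unfolding topspace_total by blast
      then have "p \<in> sheet {} j" using pt_in_sheet_iff[OF j(2,2,3)] by simp
      then show "p \<in> \<Union>{sheet {} j | j. j \<in> I \<and> sheet {} j \<noteq> ?S}" using p j(2) by blast
    next
      fix p assume "p \<in> \<Union>{sheet {} j | j. j \<in> I \<and> sheet {} j \<noteq> ?S}"
      then obtain j where j: "p \<in> sheet {} j" "j \<in> I" "sheet {} j \<noteq> ?S" by blast
      then show "p \<in> topspace total - ?S"
        using sheets_disjoint[OF j(2) i(2) j(1)] sheet_subset[OF j(2)] by blast
    qed
    moreover have "openin total (\<Union>{sheet {} j | j. j \<in> I \<and> sheet {} j \<noteq> ?S})"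
      by (intro openin_Union) (use openin_sheet in blast)
    ultimately have "closedin total ?S" using sheet_subset[OF i(2)] by (simp add: closedin_def)
    moreover have "openin total ?S" using openin_sheet[OF i(2)] by simp
    moreover have "connectedin total C" unfolding q(2) by (rule connectedin_connected_component_of)
    ultimately have "C \<subseteq> ?S \<or> disjnt C ?S" using connectedin_clopen_cases by blast
    moreover have "q \<in> C" using \<open>?S \<subseteq> C\<close> qS by blast
    ultimately show ?thesis using qS unfolding disjnt_def by blast
  qed
  ultimately show thesis using that[OF i(2)] by blast
qed

end

section \<open>The partial and the complete unfolding\<close>

context nice_simplicial_complex
begin

text \<open>A label is a vertex of its facet and the gluings of copies are precisely the perspectivity
  steps.\<close>

lemma nice_unfolding_partial:
  "nice_unfolding d K {(\<sigma>, v). \<sigma> \<in> facets d K \<and> v \<in> \<sigma>} (\<lambda>(\<sigma>, v) (\<tau>, w). w = perspectivity \<sigma> \<tau> v)"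
  (is "nice_unfolding d K ?I ?G")
proof unfold_locales
  fix i assume "i \<in> ?I"
  then show "fst i \<in> facets d K" by auto
next
  fix i j assume "i \<in> ?I" "j \<in> ?I" "neighbors d K (fst i) (fst j)" "?G i j"
  then show "?G j i" using perspectivity_inverse by (fastforce split: prod.splits)
next
  fix i \<tau> assume i: "i \<in> ?I" "neighbors d K (fst i) \<tau>"
  obtain \<sigma> v where "i = (\<sigma>, v)" by (metis surj_pair)
  then have "(\<tau>, perspectivity \<sigma> \<tau> v) \<in> ?I" "?G i (\<tau>, perspectivity \<sigma> \<tau> v)"
    using i perspectivity_in[of d K \<sigma> \<tau> v] by (simp_all add: neighbors_def)
  then show "\<exists>l. (\<tau>, l) \<in> ?I \<and> ?G i (\<tau>, l)" by blast
next
  fix \<kappa> i j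
  assume \<kappa>: "\<kappa> \<in> K" "\<kappa> \<notin> odd_subcomplex d K"
    and g: "(glued d K ?I ?G \<kappa>)\<^sup>*\<^sup>* i j" and eq: "fst i = fst j"
  have "step \<kappa> i j" if "glued d K ?I ?G \<kappa> i j" for i j
    using that by (cases i; cases j) (simp add: glued_def perspectivity_step_def)
  then have "(glued d K ?I ?G \<kappa>)\<^sup>*\<^sup>* \<le> (step \<kappa>)\<^sup>*\<^sup>*" by (intro rtranclp_mono predicate2I)
  then have "(step \<kappa>)\<^sup>*\<^sup>* i j" using g by (rule predicate2D)
  then have "(step \<kappa>)\<^sup>*\<^sup>* (fst i, snd i) (fst i, snd j)" using eq by (cases i; cases j) simp
  then have "snd i = snd j"
    using trivial_holonomy_off_odd[OF \<kappa>] unfolding trivial_holonomy_def by blast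
  then show "i = j" using eq by (simp add: prod_eq_iff)
qed

end

locale colored_base_facet = nice_simplicial_complex d K
  for d :: nat and K :: "'v set set" +
  fixes \<sigma>\<^sub>0 :: "'v set" and b\<^sub>0 :: "'v \<Rightarrow> nat"
  assumes base_facet: "\<sigma>\<^sub>0 \<in> facets d K" and base_coloring: "bij_betw b\<^sub>0 \<sigma>\<^sub>0 {0..d}"
begin

definition path_coloring :: "'v set list \<Rightarrow> 'v \<Rightarrow> nat" where
  "path_coloring \<eta> = compose (last \<eta>) b\<^sub>0 (projectivity (rev \<eta>))"

definition colored where
  "colored = {(\<sigma>, b). \<sigma> \<in> facets d K \<and> admissible_coloring d K \<sigma>\<^sub>0 b\<^sub>0 \<sigma> b}"

definition agree :: "'v set \<times> ('v \<Rightarrow> nat) \<Rightarrow> 'v set \<times> ('v \<Rightarrow> nat) \<Rightarrow> bool" where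
  "agree = (\<lambda>(\<sigma>, b) (\<tau>, c). \<forall>v\<in>\<sigma> \<inter> \<tau>. b v = c v)"

lemma admissible_iff_path_coloring:
  "admissible_coloring d K \<sigma>\<^sub>0 b\<^sub>0 \<sigma> b \<longleftrightarrow>
     (\<exists>\<eta>. facet_path d K \<eta> \<and> hd \<eta> = \<sigma>\<^sub>0 \<and> last \<eta> = \<sigma> \<and> b = path_coloring \<eta>)"
  unfolding admissible_coloring_def path_coloring_def by metis

lemma path_coloring_base: "path_coloring [\<sigma>\<^sub>0] = restrict b\<^sub>0 \<sigma>\<^sub>0"
  by (simp add: path_coloring_def compose_def restrict_def fun_eq_iff)

text \<open>An admissible coloring is obtained from the base coloring by propagating it facet by facet; the
  reversal in the definition is absorbed here.\<close>

lemma path_coloring_snoc: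
  assumes n: "neighbors d K (last \<eta>) \<tau>" and ne: "\<eta> \<noteq> []"
  shows "path_coloring (\<eta> @ [\<tau>]) = compose \<tau> (path_coloring \<eta>) (perspectivity \<tau> (last \<eta>))"
proof
  fix x
  have rev: "rev \<eta> = last \<eta> # rev (butlast \<eta>)"
    by (subst append_butlast_last_id[OF ne, symmetric]) (simp only: rev_append rev.simps append.simps)
  have "perspectivity \<tau> (last \<eta>) x \<in> last \<eta>" if "x \<in> \<tau>"
    using that by (rule perspectivity_in[OF neighbors_sym[OF n]])
  then show "path_coloring (\<eta> @ [\<tau>]) x = compose \<tau> (path_coloring \<eta>) (perspectivity \<tau> (last \<eta>)) x"
    by (simp add: path_coloring_def compose_def rev)
qed

lemma facet_path_snoc:
  assumes "\<eta> \<noteq> []"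
  shows "facet_path d K (\<eta> @ [\<tau>]) \<longleftrightarrow> facet_path d K \<eta> \<and> neighbors d K (last \<eta>) \<tau>"
  using assms by (auto simp: facet_path_def successively_append_iff neighbors_def)

lemma path_coloring_agrees:
  assumes "neighbors d K (last \<eta>) \<tau>" "\<eta> \<noteq> []"
  shows "agree (last \<eta>, path_coloring \<eta>) (\<tau>, path_coloring (\<eta> @ [\<tau>]))"
  unfolding agree_def path_coloring_snoc[OF assms] by (simp add: compose_def perspectivity_fix)

lemma path_coloring_bij:
  assumes "facet_path d K \<eta>" "hd \<eta> = \<sigma>\<^sub>0"
  shows "bij_betw (path_coloring \<eta>) (last \<eta>) {0..d}"
  using assms
proof (induction \<eta> rule: rev_induct)
  case Nil
  then show ?case by (simp add: facet_path_def)
next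
  case (snoc \<tau> \<eta>)
  show ?case
  proof (cases "\<eta> = []")
    case True
    then have "\<eta> @ [\<tau>] = [\<sigma>\<^sub>0]" using snoc.prems by simp
    then show ?thesis using path_coloring_base base_coloring bij_betw_restrict_eq by (metis last.simps)
  next
    case False
    then have p: "facet_path d K \<eta>" "hd \<eta> = \<sigma>\<^sub>0" and n: "neighbors d K (last \<eta>) \<tau>"
      using snoc.prems facet_path_snoc[OF False] by simp_all
    have b: "bij_betw (path_coloring \<eta>) (last \<eta>) {0..d}" by (rule snoc.IH[OF p])
    note n' = neighbors_sym[OF n]
    have "bij_betw (perspectivity \<tau> (last \<eta>)) \<tau> (last \<eta>)"
      by (rule bij_betw_byWitness[where f' = "perspectivity (last \<eta>) \<tau>"])
        (use perspectivity_in[OF n] perspectivity_in[OF n'] perspectivity_inverse[OF n]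
          perspectivity_inverse[OF n'] in \<open>simp_all add: image_subset_iff\<close>)
    then have "bij_betw (path_coloring \<eta> \<circ> perspectivity \<tau> (last \<eta>)) \<tau> {0..d}" using b by (rule bij_betw_trans)
    then have "bij_betw (path_coloring (\<eta> @ [\<tau>])) \<tau> {0..d}"
      unfolding path_coloring_snoc[OF n False] compose_def bij_betw_restrict_eq by (simp add: comp_def)
    then show ?thesis by simp
  qed
qed

lemma colored_iff: "(\<sigma>, b) \<in> colored \<longleftrightarrow> (\<exists>\<eta>. facet_path d K \<eta> \<and> hd \<eta> = \<sigma>\<^sub>0 \<and> last \<eta> = \<sigma> \<and> b = path_coloring \<eta>)"
proof -
  have "last \<eta> \<in> facets d K" if "facet_path d K \<eta>" for \<eta>
    using that last_in_set[of \<eta>] unfolding facet_path_def by blast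
  then show ?thesis unfolding colored_def mem_Collect_eq prod.case admissible_iff_path_coloring by blast
qed

lemma colored_bij: "(\<sigma>, b) \<in> colored \<Longrightarrow> bij_betw b \<sigma> {0..d}"
  unfolding colored_iff using path_coloring_bij by metis

lemma colored_extensional: "(\<sigma>, b) \<in> colored \<Longrightarrow> b \<in> extensional \<sigma>"
  unfolding colored_iff path_coloring_def by (elim exE conjE) (simp add: compose_extensional)

lemma colored_facet: "i \<in> colored \<Longrightarrow> fst i \<in> facets d K"
  by (auto simp: colored_def)

lemma glued_colored_step:
  assumes "glued d K colored agree \<kappa> i j" "x \<in> fst i"
  shows "step \<kappa> (fst i, x) (fst j, perspectivity (fst i) (fst j) x)"
    and "snd j (perspectivity (fst i) (fst j) x) = snd i x"
proof -
  obtain \<sigma> b \<tau> c where ij: "i = (\<sigma>, b)" "j = (\<tau>, c)" by (metis surj_pair)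
  have g: "i \<in> colored" "j \<in> colored" "neighbors d K \<sigma> \<tau>" "agree i j" "\<kappa> \<subseteq> \<sigma> \<inter> \<tau>"
    using assms(1) ij by (simp_all add: glued_def)
  then show "step \<kappa> (fst i, x) (fst j, perspectivity (fst i) (fst j) x)"
    using assms(2) ij by (simp add: perspectivity_step_def)
  show "snd j (perspectivity (fst i) (fst j) x) = snd i x"
    using perspectivity_eq_iff_ridge[OF g(3), of b "{0..d}" c] colored_bij g(1,2,4) ij assms(2)
    by (simp add: agree_def)
qed

lemma glued_colored_steps:
  assumes "(glued d K colored agree \<kappa>)\<^sup>*\<^sup>* i j" "x \<in> fst i"
  shows "\<exists>y\<in>fst j. (step \<kappa>)\<^sup>*\<^sup>* (fst i, x) (fst j, y) \<and> snd j y = snd i x"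
  using assms
proof (induction rule: rtranclp_induct)
  case (step j k)
  then obtain y where y: "y \<in> fst j" "(perspectivity_step d K \<kappa>)\<^sup>*\<^sup>* (fst i, x) (fst j, y)" "snd j y = snd i x"
    by blast
  note s = glued_colored_step[OF step.hyps(2) y(1)]
  have n: "neighbors d K (fst j) (fst k)" using step.hyps(2) by (simp add: glued_def)
  show ?case
  proof (intro bexI conjI)
    show "perspectivity (fst j) (fst k) y \<in> fst k" by (rule perspectivity_in[OF n y(1)])
    show "(perspectivity_step d K \<kappa>)\<^sup>*\<^sup>* (fst i, x) (fst k, perspectivity (fst j) (fst k) y)"
      using y(2) s(1) by (rule rtranclp.rtrancl_into_rtrancl)
    show "snd k (perspectivity (fst j) (fst k) y) = snd i x" using s(2) y(3) by simp
  qed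
qed blast

text \<open>A chain of gluings around \<open>\<kappa>\<close> carries along, with each vertex, its color.  If the chain ends
  over the facet where it started, each vertex has returned to itself, so the two colorings are
  equal.\<close>

lemma nice_unfolding_complete: "nice_unfolding d K colored agree"
proof unfold_locales
  fix i assume "i \<in> colored"
  then show "fst i \<in> facets d K" by (rule colored_facet)
next
  fix i j :: "'v set \<times> ('v \<Rightarrow> nat)" assume "agree i j"
  then show "agree j i" by (cases i; cases j) (auto simp: agree_def)
next
  fix i :: "'v set \<times> ('v \<Rightarrow> nat)" and \<tau> assume i: "i \<in> colored" "neighbors d K (fst i) \<tau>"
  then obtain \<eta> where \<eta>: "facet_path d K \<eta>" "hd \<eta> = \<sigma>\<^sub>0" "last \<eta> = fst i" "snd i = path_coloring \<eta>"
    using colored_iff[of "fst i" "snd i"] unfolding prod.collapse by blast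
  then have ne: "\<eta> \<noteq> []" by (simp add: facet_path_def)
  have n: "neighbors d K (last \<eta>) \<tau>" using i(2) \<eta>(3) by simp
  have "(\<tau>, path_coloring (\<eta> @ [\<tau>])) \<in> colored"
    unfolding colored_iff using facet_path_snoc[OF ne] \<eta>(1,2) n ne
    by (intro exI[of _ "\<eta> @ [\<tau>]"]) simp
  moreover have "agree i (\<tau>, path_coloring (\<eta> @ [\<tau>]))"
    using path_coloring_agrees[OF n ne] unfolding \<eta>(3) \<eta>(4)[symmetric] prod.collapse .
  ultimately show "\<exists>l. (\<tau>, l) \<in> colored \<and> agree i (\<tau>, l)" by blast
next
  fix \<kappa> and i j :: "'v set \<times> ('v \<Rightarrow> nat)"
  assume \<kappa>: "\<kappa> \<in> K" "\<kappa> \<notin> odd_subcomplex d K"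
    and g: "(glued d K colored agree \<kappa>)\<^sup>*\<^sup>* i j" and eq: "fst i = fst j"
  show "i = j"
  proof (cases "i = j")
    case False
    have "i \<in> colored"
      using g False by (cases rule: converse_rtranclpE) (simp_all add: glued_def)
    moreover have "j \<in> colored"
      using g False by (cases rule: rtranclp.cases) (simp_all add: glued_def)
    ultimately have ext: "snd i \<in> extensional (fst i)" "snd j \<in> extensional (fst i)"
      using colored_extensional eq by (cases i; cases j; simp)+
    have "snd i x = snd j x" if x: "x \<in> fst i" for x
    proof -
      obtain y where y: "(step \<kappa>)\<^sup>*\<^sup>* (fst i, x) (fst i, y)" "snd j y = snd i x"
        using glued_colored_steps[OF g x] unfolding eq[symmetric] by blast
      then have "x = y" using trivial_holonomy_off_odd[OF \<kappa>] unfolding trivial_holonomy_def by blast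
      then show ?thesis using y(2) by simp
    qed
    then have "snd i = snd j" by (rule extensionalityI[OF ext])
    then show ?thesis using eq by (simp add: prod_eq_iff)
  qed
qed

lemma base_in_colored: "(\<sigma>\<^sub>0, restrict b\<^sub>0 \<sigma>\<^sub>0) \<in> colored"
  unfolding colored_iff path_coloring_base[symmetric] using base_facet
  by (intro exI[of _ "[\<sigma>\<^sub>0]"]) (simp add: facet_path_def)

lemma colored_reachable:
  assumes "facet_path d K \<eta>" "hd \<eta> = \<sigma>\<^sub>0"
  shows "(glued d K colored agree {})\<^sup>*\<^sup>* (\<sigma>\<^sub>0, restrict b\<^sub>0 \<sigma>\<^sub>0) (last \<eta>, path_coloring \<eta>)"
  using assms
proof (induction \<eta> rule: rev_induct)
  case Nil
  then show ?case by (simp add: facet_path_def)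
next
  case (snoc \<tau> \<eta>)
  show ?case
  proof (cases "\<eta> = []")
    case True
    then show ?thesis using snoc.prems path_coloring_base by simp
  next
    case False
    have n: "facet_path d K \<eta>" "neighbors d K (last \<eta>) \<tau>" "hd \<eta> = \<sigma>\<^sub>0"
      using snoc.prems facet_path_snoc[OF False] False by simp_all
    have "(last \<eta>, path_coloring \<eta>) \<in> colored" unfolding colored_iff using n by blast
    moreover have "(\<tau>, path_coloring (\<eta> @ [\<tau>])) \<in> colored"
      unfolding colored_iff using snoc.prems by (intro exI[of _ "\<eta> @ [\<tau>]"]) simp
    ultimately have "glued d K colored agree {} (last \<eta>, path_coloring \<eta>) (\<tau>, path_coloring (\<eta> @ [\<tau>]))"
      using n(2) path_coloring_agrees[OF n(2) False] by (simp add: glued_def)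
    then show ?thesis using snoc.IH[OF n(1,3)] by (simp add: rtranclp.rtrancl_into_rtrancl)
  qed
qed

text \<open>All indices are linked to the base coloring, so the complete unfolding is a single
  sheet over the whole complex.\<close>

lemma covering_complete:
  "covering (subtopology (complete_unfolding d K \<sigma>\<^sub>0 b\<^sub>0) (unfolding_map -` odd_complement d K))
    (subtopology (realization K) (odd_complement d K)) unfolding_map"
proof -
  interpret U: nice_unfolding d K colored agree by (rule nice_unfolding_complete)
  let ?i = "(\<sigma>\<^sub>0, restrict b\<^sub>0 \<sigma>\<^sub>0)"
  have total: "complete_unfolding d K \<sigma>\<^sub>0 b\<^sub>0 = U.total"
    unfolding U.total_def unfolding complete_unfolding_def colored_def agree_def by (rule refl)
  have "U.sheet {} ?i = topspace U.total"
  proof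
    show "topspace U.total \<subseteq> U.sheet {} ?i"
    proof
      fix q assume "q \<in> topspace U.total"
      then obtain j x where j: "q = U.pt j x" "j \<in> colored" "x \<in> geo_simplex (fst j)"
        unfolding U.topspace_total by blast
      then have "(U.gl {})\<^sup>*\<^sup>* ?i j"
        using colored_iff[of "fst j" "snd j"] colored_reachable by (metis prod.collapse)
      then show "q \<in> U.sheet {} ?i" using U.pt_in_sheet_iff[OF base_in_colored j(2,3)] j(1) by simp
    qed
  qed (rule U.sheet_subset[OF base_in_colored])
  then have "subtopology U.total (U.sheet {} ?i \<inter> unfolding_map -` odd_complement d K) =
      subtopology U.total (unfolding_map -` odd_complement d K)"
    by (metis subtopology_restrict)
  then show ?thesis using U.covering_component[OF base_in_colored] unfolding total by metis
qed

end

theorem theorem3p3p2: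
  fixes K :: "'v set set" and d :: nat
  assumes "abstract_complex K"
    and "locally_finite_complex K"
    and "pure_complex d K"
    and "strongly_connected d K"
    and "nice_complex d K"
  shows "(\<forall>\<sigma>\<^sub>0\<in>facets d K. \<forall>b\<^sub>0. bij_betw b\<^sub>0 \<sigma>\<^sub>0 {0..d} \<longrightarrow>
            covering
              (subtopology (complete_unfolding d K \<sigma>\<^sub>0 b\<^sub>0) (unfolding_map -` odd_complement d K))
              (subtopology (realization K) (odd_complement d K))
              unfolding_map) \<and>
         (\<forall>C\<in>connected_components_of (partial_unfolding d K).
            covering
              (subtopology (partial_unfolding d K) (C \<inter> unfolding_map -` odd_complement d K))
              (subtopology (realization K) (odd_complement d K))
              unfolding_map)"
proof -
  interpret nice_simplicial_complex d K
    using assms by unfold_locales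
  show ?thesis
  proof (intro conjI ballI allI impI)
    fix \<sigma>\<^sub>0 and b\<^sub>0 :: "'v \<Rightarrow> nat" assume "\<sigma>\<^sub>0 \<in> facets d K" "bij_betw b\<^sub>0 \<sigma>\<^sub>0 {0..d}"
    then interpret colored_base_facet d K \<sigma>\<^sub>0 b\<^sub>0 by unfold_locales
    show "covering (subtopology (complete_unfolding d K \<sigma>\<^sub>0 b\<^sub>0) (unfolding_map -` odd_complement d K))
        (subtopology (realization K) (odd_complement d K)) unfolding_map"
      by (rule covering_complete)
  next
    fix C assume C: "C \<in> connected_components_of (partial_unfolding d K)"
    interpret U: nice_unfolding d K "{(\<sigma>, v). \<sigma> \<in> facets d K \<and> v \<in> \<sigma>}"
        "\<lambda>(\<sigma>, v) (\<tau>, w). w = perspectivity \<sigma> \<tau> v"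
      by (rule nice_unfolding_partial)
    have total: "partial_unfolding d K = U.total" unfolding partial_unfolding_def U.total_def by (rule refl)
    obtain i where i: "i \<in> {(\<sigma>, v). \<sigma> \<in> facets d K \<and> v \<in> \<sigma>}" "C = U.sheet {} i"
      using C unfolding total by (rule U.components_are_sheets)
    show "covering (subtopology (partial_unfolding d K) (C \<inter> unfolding_map -` odd_complement d K))
        (subtopology (realization K) (odd_complement d K)) unfolding_map"
      unfolding total i(2) by (rule U.covering_component[OF i(1)])
  qed
qed

end
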